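(* The functor $-\otimes_{\mathbb{F}_1}\mathbb{Z}:\mathbb{F}_1\mathbf{Mod}\to\mathbf{Ab}$ extends to commutative $\mathbb{F}_1$-algebras: the assignment $A\mapsto A\otimes_{\mathbb{F}_1}\mathbb{Z}$ (the commutative ring defined in the context) is the object part of a functor $-\otimes_{\mathbb{F}_1}\mathbb{Z}:\mathbb{F}_1\mathbf{Alg}\to\mathbf{CRing}$, which is left adjoint to the Eilenberg-MacLane functor $H:\mathbf{CRing}\to\mathbb{F}_1\mathbf{Alg}$, yielding an adjunction $$-\otimes_{\mathbb{F}_1}\mathbb{Z}:\mathbb{F}_1\mathbf{Alg}\leftrightarrows\mathbf{CRing}:H.$$ That is, there is a bijection $$\mathrm{Hom}_{\mathbb{F}_1\mathbf{Alg}}(A,HR)\cong\mathrm{Hom}_{\mathbf{CRing}}(A\otimes_{\mathbb{F}_1}\mathbb{Z},R)$$ natural in the commutative $\mathbb{F}_1$-algebra $A$ and the commutative ring $R$.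
   Context: **$\Gamma$-sets.** $\Gamma^{\mathrm{op}}$ is the category whose objects are the pointed finite sets $n_+=\{0,1,\ldots,n\}$, $n\ge0$, with basepoint $0$, and whose morphisms are basepoint-preserving maps. An $\mathbb{F}_1$-module ($=\Gamma$-set) is a pointed functor $X:\Gamma^{\mathrm{op}}\to\mathbf{Set}_*$ (pointed: $X(0_+)=\{*\}$); morphisms are natural transformations. The category of these is $\mathbb{F}_1\mathbf{Mod}$. **Binary sums.** Let $p_1,p_2,s:2_+\to1_+$ be the pointed maps with $p_1(1)=1,\ p_1(2)=0$; $p_2(1)=0,\ p_2(2)=1$; $s(1)=s(2)=1$. For $a,b\in X(1_+)$, $a\oplus b:=\{X(s)(z)\mid z\in X(2_+),\ X(p_1)(z)=a,\ X(p_2)(z)=b\}$. **Commutative $\mathbb{F}_1$-algebras.** The category of $\Gamma$-sets is symmetric monoidal under the smash product (Day convolution) $(F\wedge G)(k_+)=\mathrm{colim}_{m_+\wedge n_+\to k_+}F(m_+)\wedge G(n_+)$, with unit the $\Gamma$-set $\mathbb{F}_1$ given by $\mathbb{F}_1(n_+)=n_+$. A commutative $\mathbb{F}_1$-algebra is a commutative monoid object $(A,\mu,\eta)$ in this category. Equivalently (identifying $m_+\wedge n_+\cong(mn)_+$, say lexicographically), it is a $\Gamma$-set $A$ with basepoint-preserving maps $\mu_{m,n}:A(m_+)\wedge A(n_+)\to A(m_+\wedge n_+)$ natural in $m_+$ and $n_+$, together with a unit element $1_A\in A(1_+)$ (the image of $1\in\mathbb{F}_1(1_+)$ under $\eta$),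 such that $\mu$ is associative, unital with respect to $1_A$, and commutative up to the symmetry $m_+\wedge n_+\cong n_+\wedge m_+$. Morphisms are morphisms of $\Gamma$-sets preserving multiplication and unit; the category is $\mathbb{F}_1\mathbf{Alg}$. The map $\mu_{1,1}$ makes $A(1_+)$ a commutative monoid (product $a\cdot_A b$, unit $1_A$) in which the basepoint $*$ is absorbing. $\mathbf{CRing}$ is the category of commutative (unital) rings. **Eilenberg-MacLane algebras.** For a commutative ring $R$, $HR$ is the $\Gamma$-set with $HR(n_+)=R^{\oplus n}$ (basepoint $0$) and, for $f:n_+\to k_+$, $HR(f)(r_1,\ldots,r_n)=\left(\sum_{f(i)=1}r_i,\ldots,\sum_{f(i)=k}r_i\right)$. It has multiplication $((x_i)_{i\le m},(y_j)_{j\le n})\mapsto(x_iy_j)_{(i,j)}\in HR(m_+\wedge n_+)$ and unit $1_R\in R=HR(1_+)$. On morphisms $H$ applies a ring homomorphism coordinatewise. **Extension of scalars for modules.** For an $\mathbb{F}_1$-module $X$, $X\otimes_{\mathbb{F}_1}\mathbb{Z}$ is the quotient of the free abelian group $\mathbb{Z}[X(1_+)]$ with generators $[a]$, $a\in X(1_+)$, by the subgroup generated by $[*]$ and all $[a]+[b]-[c]$ with $c\in a\oplus b$. A morphism $\varphi:X\to Y$ induces $[a]\mapsto[\varphi(a)]$. **Extension of scalars for algebras.** For a commutative $\mathbb{F}_1$-algebra $A$, $A\otimes_{\mathbb{F}_1}\mathbb{Z}:=\mathbb{Z}[A(1_+)]/\mathcal{R}$, where $\mathbb{Z}[A(1_+)]$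 is the monoid ring of the commutative monoid $A(1_+)$ (free abelian group on all elements $[a]$, $a\in A(1_+)$, with $[a]\cdot[b]=[a\cdot_A b]$ and unit $[1_A]$), and $\mathcal{R}$ is the ideal generated by $[*]$ and by all $[a]+[b]-[c]$ with $a,b,c\in A(1_+)$ and $c\in a\oplus b$. *)

theory Defs
  imports "HOL-Algebra.QuotRing" "HOL-Algebra.Generated_Groups" "HOL-Algebra.Free_Abelian_Groups"
begin

section \<open>Categories and functors\<close>

text \<open>
  Objects range over a type and morphisms over another; morphisms need not know their domain and
  codomain, so composition, and the arrow part of a functor, take the objects as arguments:
  \<open>cat_comp C x y z g f\<close> composes \<open>f : x \<rightarrow> y\<close> with \<open>g : y \<rightarrow> z\<close>.
\<close>

record ('o, 'm) cat =
  cat_obj :: "'o set"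
  cat_hom :: "'o \<Rightarrow> 'o \<Rightarrow> 'm set"
  cat_id :: "'o \<Rightarrow> 'm"
  cat_comp :: "'o \<Rightarrow> 'o \<Rightarrow> 'o \<Rightarrow> 'm \<Rightarrow> 'm \<Rightarrow> 'm"

locale category =
  fixes C :: "('o, 'm) cat"
  assumes id_hom: "x \<in> cat_obj C \<Longrightarrow> cat_id C x \<in> cat_hom C x x"
    and comp_hom: "\<lbrakk>x \<in> cat_obj C; y \<in> cat_obj C; z \<in> cat_obj C;
      f \<in> cat_hom C x y; g \<in> cat_hom C y z\<rbrakk> \<Longrightarrow> cat_comp C x y z g f \<in> cat_hom C x z"
    and comp_id_right: "\<lbrakk>x \<in> cat_obj C; y \<in> cat_obj C; f \<in> cat_hom C x y\<rbrakk>
      \<Longrightarrow> cat_comp C x x y f (cat_id C x) = f"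
    and comp_id_left: "\<lbrakk>x \<in> cat_obj C; y \<in> cat_obj C; f \<in> cat_hom C x y\<rbrakk>
      \<Longrightarrow> cat_comp C x y y (cat_id C y) f = f"
    and comp_assoc: "\<lbrakk>w \<in> cat_obj C; x \<in> cat_obj C; y \<in> cat_obj C; z \<in> cat_obj C;
      f \<in> cat_hom C w x; g \<in> cat_hom C x y; h \<in> cat_hom C y z\<rbrakk>
      \<Longrightarrow> cat_comp C w y z h (cat_comp C w x y g f) = cat_comp C w x z (cat_comp C x y z h g) f"

locale cat_functor = C: category C + D: category D
  for C :: "('o, 'm) cat" and D :: "('p, 'n) cat" +
  fixes Fo :: "'o \<Rightarrow> 'p" and Fm :: "'o \<Rightarrow> 'o \<Rightarrow> 'm \<Rightarrow> 'n"
  assumes functor_obj: "x \<in> cat_obj C \<Longrightarrow> Fo x \<in> cat_obj D"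
    and functor_hom: "\<lbrakk>x \<in> cat_obj C; y \<in> cat_obj C; f \<in> cat_hom C x y\<rbrakk>
      \<Longrightarrow> Fm x y f \<in> cat_hom D (Fo x) (Fo y)"
    and functor_id: "x \<in> cat_obj C \<Longrightarrow> Fm x x (cat_id C x) = cat_id D (Fo x)"
    and functor_comp: "\<lbrakk>x \<in> cat_obj C; y \<in> cat_obj C; z \<in> cat_obj C;
      f \<in> cat_hom C x y; g \<in> cat_hom C y z\<rbrakk>
      \<Longrightarrow> Fm x z (cat_comp C x y z g f) = cat_comp D (Fo x) (Fo y) (Fo z) (Fm y z g) (Fm x y f)"


section \<open>Abelian groups and commutative rings\<close>

text \<open>
  Maps are made extensional (\<^const>\<open>undefined\<close> outside the carrier), so that equality in a hom-set
  is equality of maps on the carrier.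
\<close>

definition ab_hom :: "'a monoid \<Rightarrow> 'b monoid \<Rightarrow> ('a \<Rightarrow> 'b) set" where
  "ab_hom G K = hom G K \<inter> extensional (carrier G)"

definition Ab :: "('a monoid, 'a \<Rightarrow> 'a) cat" where
  "Ab = \<lparr>cat_obj = {G. comm_group G},
         cat_hom = ab_hom,
         cat_id = (\<lambda>G. \<lambda>x\<in>carrier G. x),
         cat_comp = (\<lambda>G K L h g. compose (carrier G) h g)\<rparr>"

definition cring_hom :: "'a ring \<Rightarrow> 'b ring \<Rightarrow> ('a \<Rightarrow> 'b) set" where
  "cring_hom R S = ring_hom R S \<inter> extensional (carrier R)"

definition CRing :: "('a ring, 'a \<Rightarrow> 'a) cat" where
  "CRing = \<lparr>cat_obj = {R. cring R},
            cat_hom = cring_hom,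
            cat_id = (\<lambda>R. \<lambda>x\<in>carrier R. x),
            cat_comp = (\<lambda>R S T h g. compose (carrier R) h g)\<rparr>"


section \<open>\<open>\<Gamma>\<close>-sets\<close>

text \<open>
  The object \<open>n\<^sub>+\<close> is represented by \<open>n\<close>, its underlying set being \<open>{..n}\<close>. In \<open>gmap X m n f\<close>
  the map \<open>f\<close> goes from \<open>m\<^sub>+\<close> to \<open>n\<^sub>+\<close>.
\<close>

definition gamma_maps :: "nat \<Rightarrow> nat \<Rightarrow> (nat \<Rightarrow> nat) set" where
  "gamma_maps m n = {f \<in> {..m} \<rightarrow>\<^sub>E {..n}. f 0 = 0}"

record 'a gset =
  gobj :: "nat \<Rightarrow> 'a set"
  gbase :: "nat \<Rightarrow> 'a"
  gmap :: "nat \<Rightarrow> nat \<Rightarrow> (nat \<Rightarrow> nat) \<Rightarrow> 'a \<Rightarrow> 'a"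

locale gamma_set =
  fixes X :: "('a, 'e) gset_scheme"
  assumes gbase_closed: "gbase X n \<in> gobj X n"
    and gmap_closed: "\<lbrakk>f \<in> gamma_maps m n; x \<in> gobj X m\<rbrakk> \<Longrightarrow> gmap X m n f x \<in> gobj X n"
    and gmap_base: "f \<in> gamma_maps m n \<Longrightarrow> gmap X m n f (gbase X m) = gbase X n"
    and gmap_id: "x \<in> gobj X n \<Longrightarrow> gmap X n n (\<lambda>i\<in>{..n}. i) x = x"
    and gmap_comp: "\<lbrakk>f \<in> gamma_maps l m; g \<in> gamma_maps m n; x \<in> gobj X l\<rbrakk>
      \<Longrightarrow> gmap X l n (compose {..l} g f) x = gmap X m n g (gmap X l m f x)"
    and gobj_0: "gobj X 0 = {gbase X 0}"

definition gset_hom ::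
  "('a, 'e) gset_scheme \<Rightarrow> ('b, 'f) gset_scheme \<Rightarrow> (nat \<Rightarrow> 'a \<Rightarrow> 'b) set" where
  "gset_hom X Y = {\<phi>.
     (\<forall>n. \<phi> n \<in> gobj X n \<rightarrow>\<^sub>E gobj Y n) \<and>
     (\<forall>n. \<phi> n (gbase X n) = gbase Y n) \<and>
     (\<forall>m n. \<forall>f\<in>gamma_maps m n. \<forall>x\<in>gobj X m. \<phi> n (gmap X m n f x) = gmap Y m n f (\<phi> m x))}"

definition gset_id :: "('a, 'e) gset_scheme \<Rightarrow> nat \<Rightarrow> 'a \<Rightarrow> 'a" where
  "gset_id X = (\<lambda>n. \<lambda>x\<in>gobj X n. x)"

definition gset_comp ::
  "('a, 'e) gset_scheme \<Rightarrow> (nat \<Rightarrow> 'b \<Rightarrow> 'c) \<Rightarrow> (nat \<Rightarrow> 'a \<Rightarrow> 'b) \<Rightarrow> nat \<Rightarrow> 'a \<Rightarrow> 'c" where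
  "gset_comp X \<psi> \<phi> = (\<lambda>n. compose (gobj X n) (\<psi> n) (\<phi> n))"

definition F1Mod :: "('a gset, nat \<Rightarrow> 'a \<Rightarrow> 'a) cat" where
  "F1Mod = \<lparr>cat_obj = {X. gamma_set X},
            cat_hom = gset_hom,
            cat_id = gset_id,
            cat_comp = (\<lambda>X Y Z. gset_comp X)\<rparr>"

definition gamma_p1 :: "nat \<Rightarrow> nat" where
  "gamma_p1 = (\<lambda>i\<in>{..2}. if i = 1 then 1 else 0)"

definition gamma_p2 :: "nat \<Rightarrow> nat" where
  "gamma_p2 = (\<lambda>i\<in>{..2}. if i = 2 then 1 else 0)"

definition gamma_s :: "nat \<Rightarrow> nat" where
  "gamma_s = (\<lambda>i\<in>{..2}. if i = 0 then 0 else 1)"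

definition binary_sum :: "('a, 'e) gset_scheme \<Rightarrow> 'a \<Rightarrow> 'a \<Rightarrow> 'a set" where
  "binary_sum X a b =
     {gmap X 2 1 gamma_s z | z. z \<in> gobj X 2 \<and> gmap X 2 1 gamma_p1 z = a \<and> gmap X 2 1 gamma_p2 z = b}"


section \<open>Commutative \<open>\<bbbF>\<^sub>1\<close>-algebras\<close>

text \<open>
  The smash product \<open>m\<^sub>+ \<and> n\<^sub>+\<close> is identified with \<open>(m * n)\<^sub>+\<close> lexicographically:
  \<open>smash_pair n i j\<close> is the index of the class of \<open>(i, j)\<close>, and for \<open>1 \<le> k \<le> m * n\<close> the
  coordinates of \<open>k\<close> are \<open>smash_fst n k\<close> and \<open>smash_snd n k\<close>.
\<close>

definition smash_pair :: "nat \<Rightarrow> nat \<Rightarrow> nat \<Rightarrow> nat" where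
  "smash_pair n i j = (if i = 0 \<or> j = 0 then 0 else (i - 1) * n + j)"

definition smash_fst :: "nat \<Rightarrow> nat \<Rightarrow> nat" where
  "smash_fst n k = (k - 1) div n + 1"

definition smash_snd :: "nat \<Rightarrow> nat \<Rightarrow> nat" where
  "smash_snd n k = (k - 1) mod n + 1"

text \<open>For \<open>f : m\<^sub>+ \<rightarrow> m'\<^sub>+\<close> and \<open>g : n\<^sub>+ \<rightarrow> n'\<^sub>+\<close>, \<open>smash_map m n n' f g\<close> is \<open>f \<and> g\<close>.\<close>

definition smash_map ::
  "nat \<Rightarrow> nat \<Rightarrow> nat \<Rightarrow> (nat \<Rightarrow> nat) \<Rightarrow> (nat \<Rightarrow> nat) \<Rightarrow> nat \<Rightarrow> nat" where
  "smash_map m n n' f g =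
     (\<lambda>k\<in>{..m * n}. if k = 0 then 0 else smash_pair n' (f (smash_fst n k)) (g (smash_snd n k)))"

definition smash_swap :: "nat \<Rightarrow> nat \<Rightarrow> nat \<Rightarrow> nat" where
  "smash_swap m n =
     (\<lambda>k\<in>{..m * n}. if k = 0 then 0 else smash_pair m (smash_snd n k) (smash_fst n k))"

record 'a f1alg = "'a gset" +
  gmul :: "nat \<Rightarrow> nat \<Rightarrow> 'a \<Rightarrow> 'a \<Rightarrow> 'a"
  gunit :: 'a

text \<open>
  A pointed map out of \<open>A(m\<^sub>+) \<and> A(n\<^sub>+)\<close> is a map on pairs sending \<open>(x, *)\<close> and \<open>(*, y)\<close> to the
  basepoint. Under the lexicographic identification the associator
  \<open>(l\<^sub>+ \<and> m\<^sub>+) \<and> n\<^sub>+ \<cong> l\<^sub>+ \<and> (m\<^sub>+ \<and> n\<^sub>+)\<close> and the unitors \<open>1\<^sub>+ \<and> n\<^sub>+ \<cong> n\<^sub>+ \<cong> n\<^sub>+ \<and> 1\<^sub>+\<close> are identity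
  maps (of \<open>(l * m * n)\<^sub>+\<close> and \<open>n\<^sub>+\<close>), hence do not appear.
\<close>

locale commutative_f1_algebra = gamma_set A for A :: "'a f1alg" +
  assumes gmul_closed: "\<lbrakk>x \<in> gobj A m; y \<in> gobj A n\<rbrakk> \<Longrightarrow> gmul A m n x y \<in> gobj A (m * n)"
    and gmul_base_left: "y \<in> gobj A n \<Longrightarrow> gmul A m n (gbase A m) y = gbase A (m * n)"
    and gmul_base_right: "x \<in> gobj A m \<Longrightarrow> gmul A m n x (gbase A n) = gbase A (m * n)"
    and gmul_natural: "\<lbrakk>f \<in> gamma_maps m m'; g \<in> gamma_maps n n'; x \<in> gobj A m; y \<in> gobj A n\<rbrakk>
      \<Longrightarrow> gmul A m' n' (gmap A m m' f x) (gmap A n n' g y)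
          = gmap A (m * n) (m' * n') (smash_map m n n' f g) (gmul A m n x y)"
    and gunit_closed: "gunit A \<in> gobj A 1"
    and gmul_assoc: "\<lbrakk>x \<in> gobj A l; y \<in> gobj A m; z \<in> gobj A n\<rbrakk>
      \<Longrightarrow> gmul A (l * m) n (gmul A l m x y) z = gmul A l (m * n) x (gmul A m n y z)"
    and gmul_unit_left: "x \<in> gobj A n \<Longrightarrow> gmul A 1 n (gunit A) x = x"
    and gmul_unit_right: "x \<in> gobj A n \<Longrightarrow> gmul A n 1 x (gunit A) = x"
    and gmul_commute: "\<lbrakk>x \<in> gobj A m; y \<in> gobj A n\<rbrakk>
      \<Longrightarrow> gmap A (m * n) (n * m) (smash_swap m n) (gmul A m n x y) = gmul A n m y x"

definition f1alg_hom :: "'a f1alg \<Rightarrow> 'b f1alg \<Rightarrow> (nat \<Rightarrow> 'a \<Rightarrow> 'b) set" where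
  "f1alg_hom A B = {\<phi> \<in> gset_hom A B.
     (\<forall>m n. \<forall>x\<in>gobj A m. \<forall>y\<in>gobj A n. \<phi> (m * n) (gmul A m n x y) = gmul B m n (\<phi> m x) (\<phi> n y)) \<and>
     \<phi> 1 (gunit A) = gunit B}"

definition F1Alg :: "('a f1alg, nat \<Rightarrow> 'a \<Rightarrow> 'a) cat" where
  "F1Alg = \<lparr>cat_obj = {A. commutative_f1_algebra A},
            cat_hom = f1alg_hom,
            cat_id = gset_id,
            cat_comp = (\<lambda>A B C. gset_comp A)\<rparr>"

definition f1alg_monoid :: "'a f1alg \<Rightarrow> 'a monoid" where
  "f1alg_monoid A = \<lparr>carrier = gobj A 1, mult = gmul A 1 1, one = gunit A\<rparr>"


section \<open>Eilenberg-MacLane algebras\<close>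

text \<open>Elements of \<open>R\<^sup>n\<close> are the extensional functions on \<open>{1..n}\<close>.\<close>

definition EM :: "'r ring \<Rightarrow> (nat \<Rightarrow> 'r) f1alg" where
  "EM R = \<lparr>gobj = (\<lambda>n. {1..n} \<rightarrow>\<^sub>E carrier R),
           gbase = (\<lambda>n. \<lambda>i\<in>{1..n}. \<zero>\<^bsub>R\<^esub>),
           gmap = (\<lambda>n k f r. \<lambda>j\<in>{1..k}. \<Oplus>\<^bsub>R\<^esub>i\<in>{i \<in> {1..n}. f i = j}. r i),
           gmul = (\<lambda>m n x y. \<lambda>k\<in>{1..m * n}. x (smash_fst n k) \<otimes>\<^bsub>R\<^esub> y (smash_snd n k)),
           gunit = (\<lambda>i\<in>{1..1}. \<one>\<^bsub>R\<^esub>)\<rparr>"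

definition EM_map :: "'r ring \<Rightarrow> 's ring \<Rightarrow> ('r \<Rightarrow> 's) \<Rightarrow> nat \<Rightarrow> (nat \<Rightarrow> 'r) \<Rightarrow> nat \<Rightarrow> 's" where
  "EM_map R S h = (\<lambda>n. \<lambda>x\<in>gobj (EM R) n. \<lambda>i\<in>{1..n}. h (x i))"


section \<open>Extension of scalars to the integers\<close>

text \<open>
  Elements of the free abelian group on a set are finitely supported integer-valued functions, and
  \<open>frag_of a\<close> is the generator \<open>[a]\<close>.
\<close>

definition sum_relations :: "('a, 'e) gset_scheme \<Rightarrow> ('a \<Rightarrow>\<^sub>0 int) set" where
  "sum_relations X = insert (frag_of (gbase X 1))
     {frag_of a + frag_of b - frag_of c | a b c.
        a \<in> gobj X 1 \<and> b \<in> gobj X 1 \<and> c \<in> gobj X 1 \<and> c \<in> binary_sum X a b}"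

definition sum_subgroup :: "'a gset \<Rightarrow> ('a \<Rightarrow>\<^sub>0 int) set" where
  "sum_subgroup X = generate (free_Abelian_group (gobj X 1)) (sum_relations X)"

definition mod_tensor :: "'a gset \<Rightarrow> ('a \<Rightarrow>\<^sub>0 int) set monoid" where
  "mod_tensor X = free_Abelian_group (gobj X 1) Mod sum_subgroup X"

text \<open>
  A homomorphism compatible with the relations sends the coset of \<open>c\<close> to the coset of the image of
  \<open>c\<close>; the cosets united below then all coincide.
\<close>

definition mod_tensor_map ::
  "'a gset \<Rightarrow> 'b gset \<Rightarrow> (nat \<Rightarrow> 'a \<Rightarrow> 'b) \<Rightarrow> ('a \<Rightarrow>\<^sub>0 int) set \<Rightarrow> ('b \<Rightarrow>\<^sub>0 int) set" where
  "mod_tensor_map X Y \<phi> = (\<lambda>C\<in>carrier (mod_tensor X).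
     \<Union>c\<in>C. sum_subgroup Y #>\<^bsub>free_Abelian_group (gobj Y 1)\<^esub> frag_extend (\<lambda>a. frag_of (\<phi> 1 a)) c)"

definition monoid_ring :: "('a, 'e) monoid_scheme \<Rightarrow> ('a \<Rightarrow>\<^sub>0 int) ring" where
  "monoid_ring M =
     \<lparr>carrier = carrier (free_Abelian_group (carrier M)),
      monoid.mult = (\<lambda>c d. frag_extend (\<lambda>a. frag_extend (\<lambda>b. frag_of (a \<otimes>\<^bsub>M\<^esub> b)) d) c),
      monoid.one = frag_of \<one>\<^bsub>M\<^esub>,
      ring.zero = 0,
      ring.add = (+)\<rparr>"

definition sum_ideal :: "'a f1alg \<Rightarrow> ('a \<Rightarrow>\<^sub>0 int) set" where
  "sum_ideal A = Idl\<^bsub>monoid_ring (f1alg_monoid A)\<^esub> (sum_relations A)"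

definition alg_tensor :: "'a f1alg \<Rightarrow> ('a \<Rightarrow>\<^sub>0 int) set ring" where
  "alg_tensor A = monoid_ring (f1alg_monoid A) Quot sum_ideal A"

definition alg_tensor_map ::
  "'a f1alg \<Rightarrow> 'b f1alg \<Rightarrow> (nat \<Rightarrow> 'a \<Rightarrow> 'b) \<Rightarrow> ('a \<Rightarrow>\<^sub>0 int) set \<Rightarrow> ('b \<Rightarrow>\<^sub>0 int) set" where
  "alg_tensor_map A B \<phi> = (\<lambda>C\<in>carrier (alg_tensor A).
     \<Union>c\<in>C. sum_ideal B +>\<^bsub>monoid_ring (f1alg_monoid B)\<^esub> frag_extend (\<lambda>a. frag_of (\<phi> 1 a)) c)"

end

theory Submission
  imports Defs
begin

text \<open>
  Multiplication by an element of \<open>A(1\<^sub>+)\<close> preserves the relations \<open>[a] + [b] - [c]\<close>, so the subgroup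
  they generate in the monoid ring is an ideal and \<open>A \<otimes> \<int>\<close> is additively the module tensor product.
  Hence a ring homomorphism \<open>A \<otimes> \<int> \<rightarrow> R\<close> is a multiplicative map \<open>f : A(1\<^sub>+) \<rightarrow> R\<close> that kills the basepoint
  and is additive along binary sums. A morphism \<open>\<phi> : A \<rightarrow> HR\<close> yields such an \<open>f\<close> in degree \<open>1\<close>.
  Conversely \<open>f\<close> determines \<open>\<phi>\<close>, because the \<open>i\<close>-th coordinate of \<open>\<phi>\<^sub>n(x)\<close> must be \<open>f(A(\<pi>\<^sub>i)(x))\<close> with
  \<open>\<pi>\<^sub>i : n\<^sub>+ \<rightarrow> 1\<^sub>+\<close> the \<open>i\<close>-th projection; this formula is natural in \<open>n\<^sub>+\<close> since binary sums iterate to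
  \<open>f(A(\<chi>\<^sub>S)(x)) = \<Sum>\<^sub>i\<^sub>\<in>\<^sub>S f(A(\<pi>\<^sub>i)(x))\<close> for the indicator map \<open>\<chi>\<^sub>S\<close> of \<open>S \<subseteq> {1..n}\<close>, and it is
  multiplicative because \<open>\<pi>\<^sub>(\<^sub>i\<^sub>,\<^sub>j\<^sub>) = \<pi>\<^sub>i \<and> \<pi>\<^sub>j\<close>.
\<close>

section \<open>Categories of modules, algebras and rings\<close>

text \<open>The degree \<open>1\<close> occurs everywhere as an object of the indexing category;
  rewriting it to \<open>Suc 0\<close> would stop facts about \<open>gobj X 1\<close> from
  matching.\<close>

declare One_nat_def [simp del]

lemma compose_restrict_ident: "f \<in> extensional A \<Longrightarrow> compose A f (\<lambda>x\<in>A. x) = f"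
  by (rule extensionalityI) (auto simp: compose_def)

lemma category_Ab: "category Ab"
proof (unfold_locales, goal_cases)
  case (1 G)
  then show ?case by (auto simp: Ab_def ab_hom_def hom_def comm_group_def Group.group_def
        Group.monoid.m_closed)
next
  case (2 G K L g h)
  then interpret comm_group G by (simp add: Ab_def)
  show ?case
    using 2 by (auto simp: Ab_def ab_hom_def hom_def compose_def Pi_iff)
next
  case (5 F G K L f g h)
  then show ?case
    by (simp add: Ab_def ab_hom_def hom_def compose_assoc)
qed (simp_all add: Ab_def ab_hom_def hom_def compose_restrict_ident Id_compose)

lemma cring_hom_compose:
  assumes "f \<in> cring_hom R S" "g \<in> cring_hom S T" "cring R"
  shows "compose (carrier R) g f \<in> cring_hom R T"
proof -
  interpret R: cring R by fact
  show ?thesis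
    using assms(1,2)
    by (auto simp: cring_hom_def ring_hom_def compose_def Pi_iff)
qed

lemma category_CRing: "category CRing"
proof (unfold_locales, goal_cases)
  case (1 R)
  then interpret cring R by (simp add: CRing_def)
  show ?case
    by (auto simp: CRing_def cring_hom_def ring_hom_def)
next
  case (2 x y z f g)
  then show ?case
    by (simp add: CRing_def cring_hom_compose)
next
  case (5 R S T U f g h)
  then show ?case
    by (simp add: CRing_def cring_hom_def ring_hom_def compose_assoc)
qed (simp_all add: CRing_def cring_hom_def ring_hom_def compose_restrict_ident Id_compose)

section \<open>Morphisms of \<Gamma>-sets and of algebras\<close>

lemma gset_homD:
  assumes "\<phi> \<in> gset_hom X Y"
  shows gset_hom_funcset: "\<phi> n \<in> gobj X n \<rightarrow> gobj Y n"
    and gset_hom_closed: "x \<in> gobj X n \<Longrightarrow> \<phi> n x \<in> gobj Y n"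
    and gset_hom_ext: "\<phi> n \<in> extensional (gobj X n)"
    and gset_hom_base: "\<phi> n (gbase X n) = gbase Y n"
    and gset_hom_natural:
      "\<lbrakk>f \<in> gamma_maps m n; x \<in> gobj X m\<rbrakk> \<Longrightarrow> \<phi> n (gmap X m n f x) = gmap Y m n f (\<phi> m x)"
  using assms by (auto simp: gset_hom_def PiE_iff)

lemma gset_id_hom:
  assumes "gamma_set X"
  shows "gset_id X \<in> gset_hom X X"
proof -
  interpret gamma_set X by fact
  show ?thesis
    by (auto simp: gset_hom_def gset_id_def gbase_closed gmap_closed)
qed

lemma gset_comp_hom:
  assumes "gamma_set X" "\<phi> \<in> gset_hom X Y" "\<psi> \<in> gset_hom Y Z"
  shows "gset_comp X \<psi> \<phi> \<in> gset_hom X Z"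
proof -
  interpret gamma_set X by fact
  show ?thesis
    using gset_homD[OF assms(2)] gset_homD[OF assms(3)]
    by (auto simp: gset_hom_def gset_comp_def compose_def gbase_closed gmap_closed)
qed

lemma gset_comp_id_right: "\<phi> \<in> gset_hom X Y \<Longrightarrow> gset_comp X \<phi> (gset_id X) = \<phi>"
  by (rule ext) (simp add: gset_comp_def gset_id_def gset_hom_def PiE_def compose_restrict_ident)

lemma gset_comp_id_left: "\<phi> \<in> gset_hom X Y \<Longrightarrow> gset_comp X (gset_id Y) \<phi> = \<phi>"
  by (rule ext) (simp add: gset_comp_def gset_id_def gset_hom_def PiE_def Id_compose)

lemma gset_comp_assoc:
  assumes "\<phi> \<in> gset_hom W X"
  shows "gset_comp W \<chi> (gset_comp W \<psi> \<phi>) = gset_comp W (gset_comp X \<chi> \<psi>) \<phi>"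
proof (rule ext)
  fix n
  have "\<phi> n \<in> gobj W n \<rightarrow> gobj X n"
    using assms by (auto simp: gset_hom_def)
  then show "gset_comp W \<chi> (gset_comp W \<psi> \<phi>) n = gset_comp W (gset_comp X \<chi> \<psi>) \<phi> n"
    by (simp add: gset_comp_def compose_assoc)
qed

lemma category_F1Mod: "category F1Mod"
  by unfold_locales
    (simp_all add: F1Mod_def gset_id_hom gset_comp_hom gset_comp_id_right gset_comp_id_left
      gset_comp_assoc)

lemma f1alg_hom_gset_hom: "\<phi> \<in> f1alg_hom A B \<Longrightarrow> \<phi> \<in> gset_hom A B"
  by (simp add: f1alg_hom_def)

lemma gset_id_f1alg_hom:
  assumes "commutative_f1_algebra A"
  shows "gset_id A \<in> f1alg_hom A A"
proof -
  interpret commutative_f1_algebra A by fact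
  have "gset_id A \<in> gset_hom A A"
    by (rule gset_id_hom) unfold_locales
  then show ?thesis
    using gunit_closed by (auto simp: f1alg_hom_def gset_id_def gmul_closed)
qed

lemma gset_comp_f1alg_hom:
  assumes "commutative_f1_algebra A" "\<phi> \<in> f1alg_hom A B" "\<psi> \<in> f1alg_hom B C"
  shows "gset_comp A \<psi> \<phi> \<in> f1alg_hom A C"
proof -
  interpret commutative_f1_algebra A by fact
  have "gset_comp A \<psi> \<phi> \<in> gset_hom A C"
    using assms by (blast intro: gset_comp_hom f1alg_hom_gset_hom gamma_set_axioms)
  moreover have "\<And>n x. x \<in> gobj A n \<Longrightarrow> \<phi> n x \<in> gobj B n"
    using assms(2) by (auto simp: f1alg_hom_def intro: gset_hom_closed)
  ultimately show ?thesis
    using assms(2,3) gunit_closed by (auto simp: f1alg_hom_def gset_comp_def compose_def gmul_closed)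
qed

lemma category_F1Alg: "category F1Alg"
proof (unfold_locales, goal_cases)
  case (5 A B C D f g h)
  then show ?case
    using gset_comp_assoc[OF f1alg_hom_gset_hom] by (simp add: F1Alg_def)
qed (simp_all add: F1Alg_def gset_id_f1alg_hom gset_comp_f1alg_hom
    gset_comp_id_right[OF f1alg_hom_gset_hom] gset_comp_id_left[OF f1alg_hom_gset_hom])

section \<open>The tensor product of modules\<close>

abbreviation frag_map :: "('a \<Rightarrow> 'b) \<Rightarrow> ('a \<Rightarrow>\<^sub>0 int) \<Rightarrow> ('b \<Rightarrow>\<^sub>0 int)" where
  "frag_map f \<equiv> frag_extend (\<lambda>a. frag_of (f a))"

lemma frag_map_closed:
  assumes "f \<in> A \<rightarrow> B" "c \<in> carrier (free_Abelian_group A)"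
  shows "frag_map f c \<in> carrier (free_Abelian_group B)"
  using keys_frag_extend[of "\<lambda>a. frag_of (f a)" c] assms by fastforce

lemma frag_map_hom:
  "f \<in> A \<rightarrow> B \<Longrightarrow> frag_map f \<in> hom (free_Abelian_group A) (free_Abelian_group B)"
  by (rule homI) (simp_all only: frag_map_closed frag_extend_add mult_free_Abelian_group)

text \<open>Only values on the support enter, so components of morphisms may be compared on
  \<open>gobj X 1\<close> alone.\<close>

lemma frag_map_cong:
  "\<lbrakk>Poly_Mapping.keys c \<subseteq> A; \<And>a. a \<in> A \<Longrightarrow> f a = g a\<rbrakk> \<Longrightarrow> frag_map f c = frag_map g c"
  by (rule frag_extend_eq) auto

lemma frag_map_ident: "frag_map (\<lambda>a. a) c = c"
  by (rule frag_expansion[symmetric])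

lemma frag_map_compose: "frag_map g (frag_map f c) = frag_map (\<lambda>a. g (f a)) c"
  using frag_extend_compose[of "\<lambda>b. frag_of (g b)" f c] by (simp add: o_def)

text \<open>Two elements of a coset of \<open>N\<close> differ by a left factor in \<open>N\<close>,
  whose image lies in \<open>M\<close>, so all cosets in the union are the same one. This makes maps
  given by a union of cosets well defined.\<close>

lemma UN_cosets_eq:
  assumes "group G" "group K" "h \<in> hom G K" "subgroup N G" "subgroup M K" "h ` N \<subseteq> M"
    and x: "x \<in> carrier G"
  shows "(\<Union>c\<in>N #>\<^bsub>G\<^esub> x. M #>\<^bsub>K\<^esub> h c) = M #>\<^bsub>K\<^esub> h x"
proof -
  interpret G: group G by fact
  interpret K: group K by fact
  interpret N: subgroup N G by fact
  interpret M: subgroup M K by fact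
  have hx: "h x \<in> carrier K"
    using assms(3) x by (auto simp: hom_def)
  have "M #>\<^bsub>K\<^esub> h c = M #>\<^bsub>K\<^esub> h x" if c: "c \<in> N #>\<^bsub>G\<^esub> x" for c
  proof -
    obtain n where n: "n \<in> N" "c = n \<otimes>\<^bsub>G\<^esub> x"
      using c by (auto simp: r_coset_def)
    then have hn: "h n \<in> M"
      using assms(6) by auto
    have "h c = h n \<otimes>\<^bsub>K\<^esub> h x"
      using n x assms(3) N.mem_carrier by (simp add: hom_mult)
    then show ?thesis
      using hn hx by (metis K.coset_join2 K.coset_mult_assoc M.mem_carrier M.subset assms(5))
  qed
  moreover have "x \<in> N #>\<^bsub>G\<^esub> x"
    by (simp add: G.rcos_self assms(4) x)
  ultimately show ?thesis
    by (intro SUP_eq_const) blast+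
qed

section \<open>Relations given by binary sums\<close>

lemma sum_relations_subset:
  assumes "gamma_set X"
  shows "sum_relations X \<subseteq> carrier (free_Abelian_group (gobj X 1))"
proof -
  interpret gamma_set X by fact
  have "Poly_Mapping.keys (frag_of a + frag_of b - frag_of c) \<subseteq> gobj X 1"
    if "a \<in> gobj X 1" "b \<in> gobj X 1" "c \<in> gobj X 1" for a b c
    using that keys_diff[of "frag_of a + frag_of b" "frag_of c"] keys_add[of "frag_of a" "frag_of b"]
    by auto
  then show ?thesis
    using gbase_closed by (auto simp: sum_relations_def)
qed

lemma subgroup_sum_subgroup:
  assumes "gamma_set X"
  shows "subgroup (sum_subgroup X) (free_Abelian_group (gobj X 1))"
  unfolding sum_subgroup_def
  by (rule group.generate_is_subgroup) (use sum_relations_subset[OF assms] in auto)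

lemma gamma_p1: "gamma_p1 \<in> gamma_maps 2 1"
  and gamma_p2: "gamma_p2 \<in> gamma_maps 2 1"
  and gamma_s: "gamma_s \<in> gamma_maps 2 1"
  by (auto simp: gamma_p1_def gamma_p2_def gamma_s_def gamma_maps_def)

lemma binary_sumI:
  assumes "z \<in> gobj X 2" "gmap X 2 1 gamma_p1 z = a" "gmap X 2 1 gamma_p2 z = b"
    "gmap X 2 1 gamma_s z = c"
  shows "c \<in> binary_sum X a b"
  unfolding binary_sum_def using assms by (intro CollectI exI[of _ z]) simp

lemma sum_relationsI:
  "\<lbrakk>a \<in> gobj X 1; b \<in> gobj X 1; c \<in> gobj X 1; c \<in> binary_sum X a b\<rbrakk> \<Longrightarrow>
    frag_of a + frag_of b - frag_of c \<in> sum_relations X"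
  unfolding sum_relations_def by blast

text \<open>A witness \<open>z\<close> for \<open>c\<close> is carried to the witness
  \<open>\<phi> 2 z\<close>, by naturality with respect to \<open>gamma_p1\<close>,
  \<open>gamma_p2\<close> and \<open>gamma_s\<close>.\<close>

lemma gset_hom_binary_sum:
  assumes "\<phi> \<in> gset_hom X Y" "c \<in> binary_sum X a b"
  shows "\<phi> 1 c \<in> binary_sum Y (\<phi> 1 a) (\<phi> 1 b)"
proof -
  obtain z where z: "z \<in> gobj X 2" "gmap X 2 1 gamma_p1 z = a" "gmap X 2 1 gamma_p2 z = b"
    "c = gmap X 2 1 gamma_s z"
    using assms(2) by (auto simp: binary_sum_def)
  have "\<phi> 2 z \<in> gobj Y 2"
    using gset_hom_closed[OF assms(1) z(1)] .
  moreover have "gmap Y 2 1 gamma_p1 (\<phi> 2 z) = \<phi> 1 a" "gmap Y 2 1 gamma_p2 (\<phi> 2 z) = \<phi> 1 b"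
    "gmap Y 2 1 gamma_s (\<phi> 2 z) = \<phi> 1 c"
    using gset_hom_natural[OF assms(1) _ z(1)] gamma_p1 gamma_p2 gamma_s z by metis+
  ultimately show ?thesis
    by (rule binary_sumI)
qed

lemma frag_map_sum_relations:
  assumes "\<phi> \<in> gset_hom X Y" "c \<in> sum_relations X"
  shows "frag_map (\<phi> 1) c \<in> sum_relations Y"
proof (cases "c = frag_of (gbase X 1)")
  case True
  then show ?thesis
    using gset_hom_base[OF assms(1)] by (simp add: sum_relations_def)
next
  case False
  then obtain x y z where xyz: "c = frag_of x + frag_of y - frag_of z"
    "x \<in> gobj X 1" "y \<in> gobj X 1" "z \<in> gobj X 1" "z \<in> binary_sum X x y"
    using assms(2) unfolding sum_relations_def by blast
  then show ?thesis
    using gset_hom_closed[OF assms(1), of _ 1] gset_hom_binary_sum[OF assms(1)]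
    unfolding sum_relations_def xyz(1) frag_extend_add frag_extend_diff frag_extend_of by blast
qed

text \<open>Generating relations go to generating relations and \<open>frag_map\<close> is additive,
  so induction over the generated subgroup suffices.\<close>

lemma frag_map_sum_subgroup:
  assumes "gamma_set X" "gamma_set Y" "\<phi> \<in> gset_hom X Y" "c \<in> sum_subgroup X"
  shows "frag_map (\<phi> 1) c \<in> sum_subgroup Y"
proof -
  interpret Y: subgroup "sum_subgroup Y" "free_Abelian_group (gobj Y 1)"
    by (rule subgroup_sum_subgroup) fact
  show ?thesis
    using assms(4) unfolding sum_subgroup_def[of X]
  proof induction
    case one
    then show ?case using Y.one_closed by simp
  next
    case (incl h)
    then show ?case
      using frag_map_sum_relations[OF assms(3)] by (auto simp: sum_subgroup_def intro: generate.incl)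
  next
    case (inv h)
    then have *: "frag_map (\<phi> 1) h \<in> sum_subgroup Y"
      using frag_map_sum_relations[OF assms(3)] by (auto simp: sum_subgroup_def intro: generate.incl)
    \<comment> \<open>The group inverse is rewritten to unary minus for elements supported in the
      basis, hence the two support facts.\<close>
    have "h \<in> carrier (free_Abelian_group (gobj X 1))"
      using inv sum_relations_subset[OF assms(1)] by blast
    then have "Poly_Mapping.keys h \<subseteq> gobj X 1" by simp
    moreover have "Poly_Mapping.keys (frag_map (\<phi> 1) h) \<subseteq> gobj Y 1"
      using Y.mem_carrier[OF *] by simp
    ultimately show ?case
      using Y.m_inv_closed[OF *] by (simp add: frag_extend_minus)
  next
    case (eng h1 h2)
    then show ?case using Y.m_closed[OF eng.IH] by (simp add: frag_extend_add)
  qed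
qed

section \<open>The quotient group and the induced maps\<close>

lemma mod_tensor_cosetI:
  "c \<in> carrier (free_Abelian_group (gobj X 1)) \<Longrightarrow>
    sum_subgroup X #>\<^bsub>free_Abelian_group (gobj X 1)\<^esub> c \<in> carrier (mod_tensor X)"
  unfolding mod_tensor_def carrier_FactGroup by blast

text \<open>\<open>UN_cosets_eq\<close> applies because \<open>\<phi>\<close> respects the
  relations. The homomorphism and functor laws can then be checked on representatives.\<close>

lemma mod_tensor_map_coset:
  assumes "gamma_set X" "gamma_set Y" "\<phi> \<in> gset_hom X Y"
    and c: "c \<in> carrier (free_Abelian_group (gobj X 1))"
  shows "mod_tensor_map X Y \<phi> (sum_subgroup X #>\<^bsub>free_Abelian_group (gobj X 1)\<^esub> c) =
    sum_subgroup Y #>\<^bsub>free_Abelian_group (gobj Y 1)\<^esub> frag_map (\<phi> 1) c"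
proof -
  have "\<phi> 1 \<in> gobj X 1 \<rightarrow> gobj Y 1"
    using gset_hom_closed[OF assms(3)] by auto
  then have "(\<Union>d\<in>sum_subgroup X #>\<^bsub>free_Abelian_group (gobj X 1)\<^esub> c.
      sum_subgroup Y #>\<^bsub>free_Abelian_group (gobj Y 1)\<^esub> frag_map (\<phi> 1) d) =
    sum_subgroup Y #>\<^bsub>free_Abelian_group (gobj Y 1)\<^esub> frag_map (\<phi> 1) c"
    using assms frag_map_sum_subgroup[OF assms(1-3)]
    by (intro UN_cosets_eq) (auto simp: subgroup_sum_subgroup frag_map_hom)
  then show ?thesis
    using mod_tensor_cosetI[OF c] by (simp add: mod_tensor_map_def)
qed

lemma mod_tensor_carrierE:
  assumes "C \<in> carrier (mod_tensor X)"
  obtains c where "c \<in> carrier (free_Abelian_group (gobj X 1))"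
    "C = sum_subgroup X #>\<^bsub>free_Abelian_group (gobj X 1)\<^esub> c"
  using assms unfolding mod_tensor_def carrier_FactGroup by blast

lemma mod_tensor_mult_coset:
  assumes "gamma_set X" "c \<in> carrier (free_Abelian_group (gobj X 1))"
    "d \<in> carrier (free_Abelian_group (gobj X 1))"
  shows "(sum_subgroup X #>\<^bsub>free_Abelian_group (gobj X 1)\<^esub> c) \<otimes>\<^bsub>mod_tensor X\<^esub>
      (sum_subgroup X #>\<^bsub>free_Abelian_group (gobj X 1)\<^esub> d) =
    sum_subgroup X #>\<^bsub>free_Abelian_group (gobj X 1)\<^esub> (c + d)"
proof -
  have "normal (sum_subgroup X) (free_Abelian_group (gobj X 1))"
    using comm_group.subgroup_imp_normal[OF abelian_free_Abelian_group subgroup_sum_subgroup[OF assms(1)]] .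
  then show ?thesis
    using normal.rcos_sum[OF _ assms(2,3)] by (simp add: mod_tensor_def)
qed

lemma mod_tensor_map_hom:
  assumes "gamma_set X" "gamma_set Y" "\<phi> \<in> gset_hom X Y"
  shows "mod_tensor_map X Y \<phi> \<in> ab_hom (mod_tensor X) (mod_tensor Y)"
proof -
  have fm: "frag_map (\<phi> 1) c \<in> carrier (free_Abelian_group (gobj Y 1))"
    if "c \<in> carrier (free_Abelian_group (gobj X 1))" for c
    using frag_map_closed[OF gset_hom_funcset[OF assms(3)] that] .
  have "mod_tensor_map X Y \<phi> \<in> hom (mod_tensor X) (mod_tensor Y)"
  proof (rule homI)
    fix C assume "C \<in> carrier (mod_tensor X)"
    then obtain c where c: "c \<in> carrier (free_Abelian_group (gobj X 1))"
      "C = sum_subgroup X #>\<^bsub>free_Abelian_group (gobj X 1)\<^esub> c"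
      by (rule mod_tensor_carrierE)
    show "mod_tensor_map X Y \<phi> C \<in> carrier (mod_tensor Y)"
      unfolding c(2) mod_tensor_map_coset[OF assms c(1)] by (rule mod_tensor_cosetI[OF fm[OF c(1)]])
  next
    fix C D assume C: "C \<in> carrier (mod_tensor X)" and D: "D \<in> carrier (mod_tensor X)"
    obtain c where c: "c \<in> carrier (free_Abelian_group (gobj X 1))"
      "C = sum_subgroup X #>\<^bsub>free_Abelian_group (gobj X 1)\<^esub> c"
      using C by (rule mod_tensor_carrierE)
    obtain d where d: "d \<in> carrier (free_Abelian_group (gobj X 1))"
      "D = sum_subgroup X #>\<^bsub>free_Abelian_group (gobj X 1)\<^esub> d"
      using D by (rule mod_tensor_carrierE)
    have cd: "c + d \<in> carrier (free_Abelian_group (gobj X 1))"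
      using c d keys_add[of c d] by auto
    show "mod_tensor_map X Y \<phi> (C \<otimes>\<^bsub>mod_tensor X\<^esub> D) =
      mod_tensor_map X Y \<phi> C \<otimes>\<^bsub>mod_tensor Y\<^esub> mod_tensor_map X Y \<phi> D"
      unfolding c(2) d(2) mod_tensor_mult_coset[OF assms(1) c(1) d(1)]
        mod_tensor_map_coset[OF assms c(1)] mod_tensor_map_coset[OF assms d(1)]
        mod_tensor_map_coset[OF assms cd] mod_tensor_mult_coset[OF assms(2) fm[OF c(1)] fm[OF d(1)]]
        frag_extend_add ..
  qed
  moreover have "mod_tensor_map X Y \<phi> \<in> extensional (carrier (mod_tensor X))"
    unfolding mod_tensor_map_def by (rule restrict_extensional)
  ultimately show ?thesis
    unfolding ab_hom_def by (rule IntI)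
qed

lemma mod_tensor_map_id:
  assumes "gamma_set X"
  shows "mod_tensor_map X X (gset_id X) = (\<lambda>C\<in>carrier (mod_tensor X). C)"
proof (rule extensionalityI)
  fix C assume "C \<in> carrier (mod_tensor X)"
  then obtain c where c: "c \<in> carrier (free_Abelian_group (gobj X 1))"
    "C = sum_subgroup X #>\<^bsub>free_Abelian_group (gobj X 1)\<^esub> c"
    by (rule mod_tensor_carrierE)
  have "frag_map (gset_id X 1) c = frag_map (\<lambda>a. a) c"
    using c(1) by (intro frag_map_cong[of _ "gobj X 1"]) (auto simp: gset_id_def)
  then have "mod_tensor_map X X (gset_id X) C = C"
    unfolding c(2) mod_tensor_map_coset[OF assms assms gset_id_hom[OF assms] c(1)]
    by (simp only: frag_map_ident)
  then show "mod_tensor_map X X (gset_id X) C = (\<lambda>C\<in>carrier (mod_tensor X). C) C"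
    using \<open>C \<in> _\<close> by simp
qed (simp_all only: mod_tensor_map_def restrict_extensional compose_extensional)

lemma mod_tensor_map_comp:
  assumes X: "gamma_set X" and Y: "gamma_set Y" and Z: "gamma_set Z"
    and \<phi>: "\<phi> \<in> gset_hom X Y" and \<psi>: "\<psi> \<in> gset_hom Y Z"
  shows "mod_tensor_map X Z (gset_comp X \<psi> \<phi>) =
    compose (carrier (mod_tensor X)) (mod_tensor_map Y Z \<psi>) (mod_tensor_map X Y \<phi>)"
proof (rule extensionalityI)
  fix C assume C: "C \<in> carrier (mod_tensor X)"
  then obtain c where c: "c \<in> carrier (free_Abelian_group (gobj X 1))"
    "C = sum_subgroup X #>\<^bsub>free_Abelian_group (gobj X 1)\<^esub> c"
    by (rule mod_tensor_carrierE)
  have "frag_map (gset_comp X \<psi> \<phi> 1) c = frag_map (\<lambda>a. \<psi> 1 (\<phi> 1 a)) c"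
    using c(1) by (intro frag_map_cong[of _ "gobj X 1"]) (auto simp: gset_comp_def compose_def)
  then have "frag_map (gset_comp X \<psi> \<phi> 1) c = frag_map (\<psi> 1) (frag_map (\<phi> 1) c)"
    by (simp add: frag_map_compose)
  moreover have *: "frag_map (\<phi> 1) c \<in> carrier (free_Abelian_group (gobj Y 1))"
    using frag_map_closed[OF gset_hom_funcset[OF \<phi>] c(1)] .
  ultimately have "mod_tensor_map X Z (gset_comp X \<psi> \<phi>) C = mod_tensor_map Y Z \<psi> (mod_tensor_map X Y \<phi> C)"
    unfolding c(2) mod_tensor_map_coset[OF X Y \<phi> c(1)] mod_tensor_map_coset[OF Y Z \<psi> *]
      mod_tensor_map_coset[OF X Z gset_comp_hom[OF X \<phi> \<psi>] c(1)]
    by simp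
  then show "mod_tensor_map X Z (gset_comp X \<psi> \<phi>) C =
    compose (carrier (mod_tensor X)) (mod_tensor_map Y Z \<psi>) (mod_tensor_map X Y \<phi>) C"
    using C by (simp add: compose_def)
qed (simp_all only: mod_tensor_map_def restrict_extensional compose_extensional)

lemma comm_group_mod_tensor: "gamma_set X \<Longrightarrow> comm_group (mod_tensor X)"
  unfolding mod_tensor_def
  by (intro comm_group.abelian_FactGroup abelian_free_Abelian_group subgroup_sum_subgroup)

lemma functor_mod_tensor: "cat_functor F1Mod Ab mod_tensor mod_tensor_map"
  by (intro cat_functor.intro cat_functor_axioms.intro category_F1Mod category_Ab)
    (auto simp: F1Mod_def Ab_def comm_group_mod_tensor mod_tensor_map_hom mod_tensor_map_id
      mod_tensor_map_comp)

section \<open>The tensor product of algebras\<close>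

lemma carrier_monoid_ring [simp]: "c \<in> carrier (monoid_ring M) \<longleftrightarrow> Poly_Mapping.keys c \<subseteq> carrier M"
  and one_monoid_ring [simp]: "\<one>\<^bsub>monoid_ring M\<^esub> = frag_of \<one>\<^bsub>M\<^esub>"
  and zero_monoid_ring [simp]: "\<zero>\<^bsub>monoid_ring M\<^esub> = 0"
  and add_monoid_ring [simp]: "c \<oplus>\<^bsub>monoid_ring M\<^esub> d = c + d"
  and mult_monoid_ring: "c \<otimes>\<^bsub>monoid_ring M\<^esub> d =
    frag_extend (\<lambda>a. frag_extend (\<lambda>b. frag_of (a \<otimes>\<^bsub>M\<^esub> b)) d) c"
  by (simp_all add: monoid_ring_def)

text \<open>Being an equality of structures, this lets facts about subgroups, cosets and
  homomorphisms of the free abelian group serve for the monoid ring without transport.\<close>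

lemma add_monoid_monoid_ring: "add_monoid (monoid_ring M) = free_Abelian_group (carrier M)"
  by (simp add: monoid_ring_def free_Abelian_group_def)

text \<open>The second factor of a product in the monoid ring sits inside the function argument of
  \<open>frag_extend\<close>, so distributivity on that side rests on this.\<close>

lemma frag_extend_add_fun: "frag_extend (\<lambda>a. f a + g a) c = frag_extend f c + frag_extend g c"
  by (simp add: frag_extend_def frag_cmul_distrib2 sum.distrib)

lemma frag_extend_diff_fun: "frag_extend (\<lambda>a. f a - g a) c = frag_extend f c - frag_extend g c"
  using frag_extend_add_fun[of "\<lambda>a. f a - g a" g c] by simp

lemma monoid_ring_mult_of [simp]:
  "frag_of a \<otimes>\<^bsub>monoid_ring M\<^esub> frag_of b = frag_of (a \<otimes>\<^bsub>M\<^esub> b)"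
  by (simp add: mult_monoid_ring)

lemma monoid_ring_mult_0 [simp]:
  "0 \<otimes>\<^bsub>monoid_ring M\<^esub> d = 0" "c \<otimes>\<^bsub>monoid_ring M\<^esub> 0 = 0"
  by (simp_all add: mult_monoid_ring frag_extend_eq_0)

text \<open>Differences are treated along with sums because \<open>frag_induction\<close> builds
  elements from generators by subtraction.\<close>

lemma monoid_ring_distrib:
  "(c + c') \<otimes>\<^bsub>monoid_ring M\<^esub> d = c \<otimes>\<^bsub>monoid_ring M\<^esub> d + c' \<otimes>\<^bsub>monoid_ring M\<^esub> d"
  "c \<otimes>\<^bsub>monoid_ring M\<^esub> (d + d') = c \<otimes>\<^bsub>monoid_ring M\<^esub> d + c \<otimes>\<^bsub>monoid_ring M\<^esub> d'"
  "(c - c') \<otimes>\<^bsub>monoid_ring M\<^esub> d = c \<otimes>\<^bsub>monoid_ring M\<^esub> d - c' \<otimes>\<^bsub>monoid_ring M\<^esub> d"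
  "c \<otimes>\<^bsub>monoid_ring M\<^esub> (d - d') = c \<otimes>\<^bsub>monoid_ring M\<^esub> d - c \<otimes>\<^bsub>monoid_ring M\<^esub> d'"
  by (simp_all add: mult_monoid_ring frag_extend_add frag_extend_diff
      frag_extend_add_fun frag_extend_diff_fun)

lemma keys_diff_subset: "\<lbrakk>Poly_Mapping.keys a \<subseteq> S; Poly_Mapping.keys b \<subseteq> S\<rbrakk> \<Longrightarrow>
    Poly_Mapping.keys (a - b :: 'a \<Rightarrow>\<^sub>0 int) \<subseteq> S"
  using keys_diff[of a b] by blast

lemma monoid_ring_mult_closed:
  assumes "Group.monoid M" "Poly_Mapping.keys c \<subseteq> carrier M" "Poly_Mapping.keys d \<subseteq> carrier M"
  shows "Poly_Mapping.keys (c \<otimes>\<^bsub>monoid_ring M\<^esub> d) \<subseteq> carrier M"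
  using assms(2)
proof (induction rule: frag_induction)
  case (one a)
  show ?case
    using assms(3)
    by (induction rule: frag_induction)
      (simp_all add: Group.monoid.m_closed[OF assms(1)] one monoid_ring_distrib keys_diff_subset)
qed (simp_all add: monoid_ring_distrib keys_diff_subset)

text \<open>Both sides are additive in each argument, so nested inductions on the three elements
  leave only products of generators, where associativity of \<open>M\<close> applies. Commutativity
  and the unit law reduce to \<open>M\<close> in the same way.\<close>

lemma monoid_ring_assoc:
  assumes "Group.monoid M" "Poly_Mapping.keys c \<subseteq> carrier M" "Poly_Mapping.keys d \<subseteq> carrier M"
    "Poly_Mapping.keys e \<subseteq> carrier M"
  shows "c \<otimes>\<^bsub>monoid_ring M\<^esub> d \<otimes>\<^bsub>monoid_ring M\<^esub> e = c \<otimes>\<^bsub>monoid_ring M\<^esub> (d \<otimes>\<^bsub>monoid_ring M\<^esub> e)"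
  using assms(2)
proof (induction rule: frag_induction)
  case (one x)
  note x = one
  show ?case
    using assms(3)
  proof (induction rule: frag_induction)
    case (one y)
    show ?case
      using assms(4) by (induction rule: frag_induction)
        (auto simp: monoid_ring_distrib Group.monoid.m_assoc[OF assms(1) x one])
  qed (auto simp: monoid_ring_distrib)
qed (auto simp: monoid_ring_distrib)

lemma monoid_ring_comm:
  assumes "comm_monoid M" "Poly_Mapping.keys c \<subseteq> carrier M" "Poly_Mapping.keys d \<subseteq> carrier M"
  shows "c \<otimes>\<^bsub>monoid_ring M\<^esub> d = d \<otimes>\<^bsub>monoid_ring M\<^esub> c"
  using assms(2)
proof (induction rule: frag_induction)
  case (one x)
  show ?case
    using assms(3) by (induction rule: frag_induction)
      (auto simp: monoid_ring_distrib comm_monoid.m_comm[OF assms(1) one])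
qed (auto simp: monoid_ring_distrib)

lemma monoid_ring_one:
  assumes "Group.monoid M" "Poly_Mapping.keys c \<subseteq> carrier M"
  shows "frag_of \<one>\<^bsub>M\<^esub> \<otimes>\<^bsub>monoid_ring M\<^esub> c = c"
  using assms(2) by (induction rule: frag_induction)
    (auto simp: monoid_ring_distrib Group.monoid.l_one[OF assms(1)])

lemma cring_monoid_ring:
  assumes "comm_monoid M"
  shows "cring (monoid_ring M)"
proof (rule cringI)
  interpret comm_monoid M by fact
  note M = monoid_axioms
  show "abelian_group (monoid_ring M)"
    by (rule comm_group_abelian_groupI, unfold add_monoid_monoid_ring)
      (rule abelian_free_Abelian_group)
  show "comm_monoid (monoid_ring M)"
  proof (rule comm_monoidI)
    show "c \<otimes>\<^bsub>monoid_ring M\<^esub> d = d \<otimes>\<^bsub>monoid_ring M\<^esub> c"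
      if "c \<in> carrier (monoid_ring M)" "d \<in> carrier (monoid_ring M)" for c d
      using that by (simp add: monoid_ring_comm[OF assms])
  qed (simp_all add: monoid_ring_mult_closed[OF M] monoid_ring_assoc[OF M] monoid_ring_one[OF M])
qed (simp add: monoid_ring_distrib)

text \<open>Additivity in each factor reduces the claim to generators, where it is multiplicativity
  of \<open>f\<close>.\<close>

lemma frag_map_monoid_ring_mult:
  assumes "f \<in> hom M N" "Poly_Mapping.keys c \<subseteq> carrier M" "Poly_Mapping.keys d \<subseteq> carrier M"
  shows "frag_map f (c \<otimes>\<^bsub>monoid_ring M\<^esub> d) = frag_map f c \<otimes>\<^bsub>monoid_ring N\<^esub> frag_map f d"
  using assms(2)
proof (induction rule: frag_induction)
  case (one x)
  show ?case
    using assms(3) by (induction rule: frag_induction)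
      (auto simp: monoid_ring_distrib frag_extend_diff hom_mult[OF assms(1) one])
qed (auto simp: monoid_ring_distrib frag_extend_diff)

section \<open>The multiplicative monoid of an algebra\<close>

lemma f1alg_monoid_simps [simp]:
  "carrier (f1alg_monoid A) = gobj A 1" "\<one>\<^bsub>f1alg_monoid A\<^esub> = gunit A"
  "x \<otimes>\<^bsub>f1alg_monoid A\<^esub> y = gmul A 1 1 x y"
  by (simp_all add: f1alg_monoid_def)

text \<open>Because of this the symmetry disappears in degree \<open>1\<close>, and
  \<open>gmul_commute\<close> becomes plain commutativity of the monoid.\<close>

lemma smash_swap_1: "smash_swap 1 1 = (\<lambda>i\<in>{..1}. i)"
  by (rule ext) (auto simp: smash_swap_def smash_pair_def smash_fst_def smash_snd_def)

lemma comm_monoid_f1alg_monoid: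
  assumes "commutative_f1_algebra A"
  shows "comm_monoid (f1alg_monoid A)"
proof -
  interpret commutative_f1_algebra A by fact
  show ?thesis
  proof (rule comm_monoidI)
    fix x y assume xy: "x \<in> carrier (f1alg_monoid A)" "y \<in> carrier (f1alg_monoid A)"
    then have x: "x \<in> gobj A 1" and y: "y \<in> gobj A 1"
      by simp_all
    show "x \<otimes>\<^bsub>f1alg_monoid A\<^esub> y \<in> carrier (f1alg_monoid A)"
      using gmul_closed[OF x y] by simp
    show "x \<otimes>\<^bsub>f1alg_monoid A\<^esub> y = y \<otimes>\<^bsub>f1alg_monoid A\<^esub> x"
      using gmul_commute[OF x y] gmul_closed[OF x y] by (simp add: smash_swap_1 gmap_id)
  next
    fix x y z
    assume "x \<in> carrier (f1alg_monoid A)" "y \<in> carrier (f1alg_monoid A)"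
      "z \<in> carrier (f1alg_monoid A)"
    then show "x \<otimes>\<^bsub>f1alg_monoid A\<^esub> y \<otimes>\<^bsub>f1alg_monoid A\<^esub> z =
      x \<otimes>\<^bsub>f1alg_monoid A\<^esub> (y \<otimes>\<^bsub>f1alg_monoid A\<^esub> z)"
      using gmul_assoc[of x 1 y 1 z 1] by simp
  qed (use gunit_closed gmul_unit_left in auto)
qed

section \<open>The underlying module and the ideal of relations\<close>

lemma gset_truncate_simps [simp]:
  "gobj (gset.truncate A) = gobj A" "gbase (gset.truncate A) = gbase A"
  "gmap (gset.truncate A) = gmap A"
  by (simp_all add: gset.truncate_def)

lemma gamma_set_truncate: "gamma_set A \<Longrightarrow> gamma_set (gset.truncate A)"
  by (simp add: gamma_set_def)

lemma gset_hom_truncate: "gset_hom (gset.truncate A) (gset.truncate B) = gset_hom A B"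
  by (simp add: gset_hom_def)

lemma sum_relations_truncate: "sum_relations (gset.truncate A) = sum_relations A"
  by (simp add: sum_relations_def binary_sum_def)

lemma commutative_f1_algebra_gamma_set: "commutative_f1_algebra A \<Longrightarrow> gamma_set A"
  by (simp add: commutative_f1_algebra_def)

text \<open>Under the lexicographic identification \<open>1\<^sub>+ \<and> 2\<^sub>+\<close> is
  \<open>2\<^sub>+\<close>. So naturality of \<open>gmul\<close>, with the identity in the first
  slot, says that multiplying by a degree \<open>1\<close> element commutes with the three maps that
  define binary sums.\<close>

lemma smash_map_id_left:
  assumes "f \<in> gamma_maps 2 1"
  shows "smash_map 1 2 1 (\<lambda>i\<in>{..1}. i) f = f"
proof (rule ext)
  fix k :: nat
  have "f \<in> extensional {..2::nat}" "f 0 = 0"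
    using assms by (auto simp: gamma_maps_def PiE_iff)
  \<comment> \<open>Beyond \<open>2\<close> both sides are \<open>undefined\<close>, so these four
    cases cover all arguments.\<close>
  moreover have "k = 0 \<or> k = 1 \<or> k = 2 \<or> k > (2::nat)" by linarith
  ultimately show "smash_map 1 2 1 (\<lambda>i\<in>{..1}. i) f k = f k"
    by (auto simp: smash_map_def smash_pair_def smash_fst_def smash_snd_def extensional_def)
qed

text \<open>
  Multiplication by \<open>d \<in> A(1\<^sub>+)\<close> carries a witness \<open>z \<in> A(2\<^sub>+)\<close> of \<open>c \<in> a \<oplus> b\<close> to the witness
  \<open>\<mu>(d, z)\<close> of \<open>d c \<in> d a \<oplus> d b\<close>; hence the subgroup generated by the relations is already an ideal.
\<close>

lemma sum_relations_mult:
  assumes "commutative_f1_algebra A" "r \<in> sum_relations A" "d \<in> gobj A 1"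
  shows "frag_of d \<otimes>\<^bsub>monoid_ring (f1alg_monoid A)\<^esub> r \<in> sum_relations A"
proof -
  interpret commutative_f1_algebra A by fact
  show ?thesis
  proof (cases "r = frag_of (gbase A 1)")
    case True
    then show ?thesis
      using gmul_base_right[OF assms(3), of 1] by (simp add: sum_relations_def)
  next
    case False
    then obtain x y w where r: "r = frag_of x + frag_of y - frag_of w"
      and mem: "x \<in> gobj A 1" "y \<in> gobj A 1" "w \<in> gobj A 1" "w \<in> binary_sum A x y"
      using assms(2) unfolding sum_relations_def by blast
    obtain z where z: "z \<in> gobj A 2" "gmap A 2 1 gamma_p1 z = x" "gmap A 2 1 gamma_p2 z = y"
      "gmap A 2 1 gamma_s z = w"
      using mem(4) unfolding binary_sum_def by blast
    have id: "(\<lambda>i\<in>{..1}. i) \<in> gamma_maps 1 1"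
      by (auto simp: gamma_maps_def)
    have nat: "gmap A 2 1 f (gmul A 1 2 d z) = gmul A 1 1 d (gmap A 2 1 f z)"
      if "f \<in> gamma_maps 2 1" for f
      using gmul_natural[OF id that assms(3) z(1)] smash_map_id_left[OF that] gmap_id[OF assms(3)]
      by simp
    have "gmul A 1 1 d w \<in> binary_sum A (gmul A 1 1 d x) (gmul A 1 1 d y)"
      using gmul_closed[OF assms(3) z(1)]
      by (intro binary_sumI[of "gmul A 1 2 d z"])
        (simp_all add: nat gamma_p1 gamma_p2 gamma_s z)
    moreover have "gmul A 1 1 d v \<in> gobj A 1" if "v \<in> gobj A 1" for v
      using gmul_closed[OF assms(3) that] by simp
    ultimately show ?thesis
      unfolding r monoid_ring_distrib monoid_ring_mult_of f1alg_monoid_simps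
      by (simp add: sum_relationsI mem)
  qed
qed

text \<open>Induction over the generated subgroup handles a single generator
  \<open>frag_of d\<close> times \<open>r\<close>; additivity in the first factor then reaches every
  \<open>c\<close>.\<close>

lemma sum_subgroup_mult:
  assumes A: "commutative_f1_algebra A" and r: "r \<in> sum_subgroup (gset.truncate A)"
    and c: "Poly_Mapping.keys c \<subseteq> gobj A 1"
  shows "c \<otimes>\<^bsub>monoid_ring (f1alg_monoid A)\<^esub> r \<in> sum_subgroup (gset.truncate A)"
proof -
  note X = gamma_set_truncate[OF commutative_f1_algebra_gamma_set[OF A]]
  interpret S: subgroup "sum_subgroup (gset.truncate A)" "free_Abelian_group (gobj A 1)"
    using subgroup_sum_subgroup[OF X] by simp
  have rel: "s \<in> sum_subgroup (gset.truncate A)" if "s \<in> sum_relations A" for s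
    using that by (simp add: sum_subgroup_def sum_relations_truncate generate.incl)
  have uminus: "- s \<in> sum_subgroup (gset.truncate A)" if "s \<in> sum_subgroup (gset.truncate A)" for s
    using S.m_inv_closed[OF that] S.mem_carrier[OF that] by simp
  have plus: "s + t \<in> sum_subgroup (gset.truncate A)"
    if "s \<in> sum_subgroup (gset.truncate A)" "t \<in> sum_subgroup (gset.truncate A)" for s t
    using S.m_closed[OF that] by simp
  have zero: "0 \<in> sum_subgroup (gset.truncate A)"
    using S.one_closed by simp
  have of: "frag_of d \<otimes>\<^bsub>monoid_ring (f1alg_monoid A)\<^esub> r \<in> sum_subgroup (gset.truncate A)"
    if d: "d \<in> gobj A 1" for d
    using r[unfolded sum_subgroup_def sum_relations_truncate gset_truncate_simps]
  proof induction
    case one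
    then show ?case using zero by simp
  next
    case (incl s)
    then show ?case using rel[OF sum_relations_mult[OF A _ d]] by blast
  next
    case (inv s)
    \<comment> \<open>Writing the inverse as \<open>0 - s\<close> brings it under the distributive
      laws for differences.\<close>
    have "inv\<^bsub>free_Abelian_group (gobj A 1)\<^esub> s = 0 - s"
      using inv sum_relations_subset[OF X] inv_free_Abelian_group[of s "gobj A 1"]
      by (auto simp: sum_relations_truncate)
    then show ?case
      using uminus[OF rel[OF sum_relations_mult[OF A inv d]]]
      by (simp only: monoid_ring_distrib monoid_ring_mult_0) simp
  next
    case (eng s t)
    then show ?case by (simp add: monoid_ring_distrib plus)
  qed
  show ?thesis
    using c
  proof (induction rule: frag_induction)
    case (diff a b)
    then show ?case
      using plus[OF diff(1) uminus[OF diff(2)]] by (simp add: monoid_ring_distrib)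
  qed (use zero of in auto)
qed

text \<open>Each inclusion is a minimality statement: the subgroup is an ideal containing the
  relations, and the ideal is a subgroup containing them.\<close>

lemma sum_ideal_eq_sum_subgroup:
  assumes "commutative_f1_algebra A"
  shows "sum_ideal A = sum_subgroup (gset.truncate A)"
proof
  note X = gamma_set_truncate[OF commutative_f1_algebra_gamma_set[OF assms]]
  note cm = comm_monoid_f1alg_monoid[OF assms]
  interpret cring "monoid_ring (f1alg_monoid A)"
    by (rule cring_monoid_ring[OF cm])
  have sub: "sum_relations A \<subseteq> carrier (monoid_ring (f1alg_monoid A))"
    using sum_relations_subset[OF X] by (auto simp: sum_relations_truncate)
  have sg: "subgroup (sum_subgroup (gset.truncate A)) (free_Abelian_group (gobj A 1))"
    using subgroup_sum_subgroup[OF X] by simp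
  have "ideal (sum_subgroup (gset.truncate A)) (monoid_ring (f1alg_monoid A))"
  proof (rule idealI)
    show "ring (monoid_ring (f1alg_monoid A))" ..
    show "subgroup (sum_subgroup (gset.truncate A)) (add_monoid (monoid_ring (f1alg_monoid A)))"
      unfolding add_monoid_monoid_ring f1alg_monoid_simps by (rule sg)
    fix a x assume a: "a \<in> sum_subgroup (gset.truncate A)"
      and x: "x \<in> carrier (monoid_ring (f1alg_monoid A))"
    show *: "x \<otimes>\<^bsub>monoid_ring (f1alg_monoid A)\<^esub> a \<in> sum_subgroup (gset.truncate A)"
      using sum_subgroup_mult[OF assms a] x by simp
    show "a \<otimes>\<^bsub>monoid_ring (f1alg_monoid A)\<^esub> x \<in> sum_subgroup (gset.truncate A)"
      using * monoid_ring_comm[OF cm, of a x] x subgroup.mem_carrier[OF sg a] by simp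
  qed
  moreover have "sum_relations A \<subseteq> sum_subgroup (gset.truncate A)"
    by (auto simp: sum_subgroup_def sum_relations_truncate intro: generate.incl)
  ultimately show "sum_ideal A \<subseteq> sum_subgroup (gset.truncate A)"
    unfolding sum_ideal_def by (rule genideal_minimal)
  have "subgroup (sum_ideal A) (free_Abelian_group (gobj A 1))"
    using additive_subgroup.a_subgroup[OF ideal.axioms(1)[OF genideal_ideal[OF sub]]]
    unfolding sum_ideal_def add_monoid_monoid_ring f1alg_monoid_simps .
  moreover have "sum_relations A \<subseteq> sum_ideal A"
    unfolding sum_ideal_def by (rule genideal_self[OF sub])
  ultimately show "sum_subgroup (gset.truncate A) \<subseteq> sum_ideal A"
    unfolding sum_subgroup_def sum_relations_truncate gset_truncate_simps
    by (intro group.generate_subgroup_incl group_free_Abelian_group)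
qed

section \<open>The quotient ring and its additive group\<close>

lemma ideal_sum_ideal:
  assumes "commutative_f1_algebra A"
  shows "ideal (sum_ideal A) (monoid_ring (f1alg_monoid A))"
proof -
  interpret cring "monoid_ring (f1alg_monoid A)"
    by (rule cring_monoid_ring[OF comm_monoid_f1alg_monoid[OF assms]])
  show ?thesis
    unfolding sum_ideal_def
    using sum_relations_subset[OF commutative_f1_algebra_gamma_set[OF assms]]
    by (intro genideal_ideal) auto
qed

lemma cring_alg_tensor: "commutative_f1_algebra A \<Longrightarrow> cring (alg_tensor A)"
  unfolding alg_tensor_def
  by (intro ideal.quotient_is_cring ideal_sum_ideal cring_monoid_ring comm_monoid_f1alg_monoid)

text \<open>The quotient ring and the quotient group consist of the same cosets under the same
  addition, since the ideal coincides with the subgroup. Hence an equality rather than an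
  isomorphism.\<close>

lemma add_monoid_alg_tensor:
  assumes "commutative_f1_algebra A"
  shows "add_monoid (alg_tensor A) = mod_tensor (gset.truncate A)"
  unfolding alg_tensor_def mod_tensor_def FactRing_def FactGroup_def A_RCOSETS_def set_add_def
    add_monoid_monoid_ring sum_ideal_eq_sum_subgroup[OF assms] f1alg_monoid_simps
  by simp

abbreviation alg_coset :: "'a f1alg \<Rightarrow> ('a \<Rightarrow>\<^sub>0 int) \<Rightarrow> ('a \<Rightarrow>\<^sub>0 int) set" where
  "alg_coset A c \<equiv> sum_ideal A +>\<^bsub>monoid_ring (f1alg_monoid A)\<^esub> c"

lemma alg_coset_eq:
  "commutative_f1_algebra A \<Longrightarrow>
    alg_coset A c = sum_subgroup (gset.truncate A) #>\<^bsub>free_Abelian_group (gobj A 1)\<^esub> c"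
  unfolding a_r_coset_def add_monoid_monoid_ring f1alg_monoid_simps
  by (simp only: sum_ideal_eq_sum_subgroup)

lemma carrier_alg_tensor:
  assumes "commutative_f1_algebra A"
  shows "carrier (alg_tensor A) = carrier (mod_tensor (gset.truncate A))"
  using add_monoid_alg_tensor[OF assms] by (metis partial_object.select_convs(1))

text \<open>Both maps are given by the same union over a coset. Thus the identity and composition
  laws for algebras are inherited from modules.\<close>

lemma alg_tensor_map_eq:
  assumes "commutative_f1_algebra A" "commutative_f1_algebra B"
  shows "alg_tensor_map A B \<phi> = mod_tensor_map (gset.truncate A) (gset.truncate B) \<phi>"
  by (simp add: alg_tensor_map_def mod_tensor_map_def carrier_alg_tensor[OF assms(1)]
      alg_coset_eq[OF assms(2)])

lemma alg_coset_hom: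
  assumes "commutative_f1_algebra A"
  shows "alg_coset A \<in> ring_hom (monoid_ring (f1alg_monoid A)) (alg_tensor A)"
  unfolding alg_tensor_def by (rule ideal.rcos_ring_hom[OF ideal_sum_ideal[OF assms]])

lemma alg_tensor_carrierE:
  assumes "C \<in> carrier (alg_tensor A)"
  obtains c where "c \<in> carrier (monoid_ring (f1alg_monoid A))" "C = alg_coset A c"
  using assms unfolding alg_tensor_def FactRing_def A_RCOSETS_def' by auto

lemma alg_tensor_map_coset:
  assumes "commutative_f1_algebra A" "commutative_f1_algebra B" "\<phi> \<in> f1alg_hom A B"
    and "c \<in> carrier (monoid_ring (f1alg_monoid A))"
  shows "alg_tensor_map A B \<phi> (alg_coset A c) = alg_coset B (frag_map (\<phi> 1) c)"
  using assms mod_tensor_map_coset[of "gset.truncate A" "gset.truncate B" \<phi> c]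
  by (simp add: alg_tensor_map_eq alg_coset_eq gamma_set_truncate commutative_f1_algebra_gamma_set
      gset_hom_truncate f1alg_hom_gset_hom)

lemma f1alg_hom_monoid_hom:
  assumes "\<phi> \<in> f1alg_hom A B"
  shows "\<phi> 1 \<in> hom (f1alg_monoid A) (f1alg_monoid B)" "\<phi> 1 (gunit A) = gunit B"
proof -
  have "\<phi> (1 * 1) (gmul A 1 1 x y) = gmul B 1 1 (\<phi> 1 x) (\<phi> 1 y)"
    if "x \<in> gobj A 1" "y \<in> gobj A 1" for x y
    using assms that unfolding f1alg_hom_def by blast
  then show "\<phi> 1 \<in> hom (f1alg_monoid A) (f1alg_monoid B)"
    using gset_hom_closed[OF f1alg_hom_gset_hom[OF assms]] by (auto simp: hom_def)
  show "\<phi> 1 (gunit A) = gunit B"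
    using assms by (simp add: f1alg_hom_def)
qed

text \<open>\<open>alg_coset A\<close> is a ring homomorphism reaching every element, so each law
  follows from the corresponding one for \<open>frag_map (\<phi> 1)\<close> on
  representatives.\<close>

lemma alg_tensor_map_hom:
  assumes A: "commutative_f1_algebra A" and B: "commutative_f1_algebra B"
    and \<phi>: "\<phi> \<in> f1alg_hom A B"
  shows "alg_tensor_map A B \<phi> \<in> cring_hom (alg_tensor A) (alg_tensor B)"
proof -
  let ?MA = "monoid_ring (f1alg_monoid A)" and ?MB = "monoid_ring (f1alg_monoid B)"
  interpret MA: cring ?MA
    by (rule cring_monoid_ring[OF comm_monoid_f1alg_monoid[OF A]])
  note A_hom = alg_coset_hom[OF A] and B_hom = alg_coset_hom[OF B]
  note map_coset = alg_tensor_map_coset[OF A B \<phi>]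
  have fm: "frag_map (\<phi> 1) c \<in> carrier ?MB" if "c \<in> carrier ?MA" for c
    using frag_map_closed[OF gset_hom_funcset[OF f1alg_hom_gset_hom[OF \<phi>], of 1]] that by simp
  have "alg_tensor_map A B \<phi> \<in> ring_hom (alg_tensor A) (alg_tensor B)"
  proof (rule ring_hom_memI)
    fix C assume "C \<in> carrier (alg_tensor A)"
    then obtain c where c: "c \<in> carrier ?MA" "C = alg_coset A c"
      by (rule alg_tensor_carrierE)
    show "alg_tensor_map A B \<phi> C \<in> carrier (alg_tensor B)"
      unfolding c(2) map_coset[OF c(1)] by (rule ring_hom_closed[OF B_hom fm[OF c(1)]])
  next
    fix C D assume C: "C \<in> carrier (alg_tensor A)" and D: "D \<in> carrier (alg_tensor A)"
    obtain c where c: "c \<in> carrier ?MA" "C = alg_coset A c"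
      using C by (rule alg_tensor_carrierE)
    obtain d where d: "d \<in> carrier ?MA" "D = alg_coset A d"
      using D by (rule alg_tensor_carrierE)
    have "frag_map (\<phi> 1) (c \<otimes>\<^bsub>?MA\<^esub> d) = frag_map (\<phi> 1) c \<otimes>\<^bsub>?MB\<^esub> frag_map (\<phi> 1) d"
      using frag_map_monoid_ring_mult[OF f1alg_hom_monoid_hom(1)[OF \<phi>]] c(1) d(1) by simp
    then show "alg_tensor_map A B \<phi> (C \<otimes>\<^bsub>alg_tensor A\<^esub> D) =
      alg_tensor_map A B \<phi> C \<otimes>\<^bsub>alg_tensor B\<^esub> alg_tensor_map A B \<phi> D"
      unfolding c(2) d(2) map_coset[OF c(1)] map_coset[OF d(1)]
        ring_hom_mult[OF A_hom c(1) d(1), symmetric] map_coset[OF MA.m_closed[OF c(1) d(1)]]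
        ring_hom_mult[OF B_hom fm[OF c(1)] fm[OF d(1)], symmetric]
      by simp
    have "frag_map (\<phi> 1) (c \<oplus>\<^bsub>?MA\<^esub> d) = frag_map (\<phi> 1) c \<oplus>\<^bsub>?MB\<^esub> frag_map (\<phi> 1) d"
      by (simp add: frag_extend_add)
    then show "alg_tensor_map A B \<phi> (C \<oplus>\<^bsub>alg_tensor A\<^esub> D) =
      alg_tensor_map A B \<phi> C \<oplus>\<^bsub>alg_tensor B\<^esub> alg_tensor_map A B \<phi> D"
      unfolding c(2) d(2) map_coset[OF c(1)] map_coset[OF d(1)]
        ring_hom_add[OF A_hom c(1) d(1), symmetric] map_coset[OF MA.a_closed[OF c(1) d(1)]]
        ring_hom_add[OF B_hom fm[OF c(1)] fm[OF d(1)], symmetric]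
      by simp
  next
    show "alg_tensor_map A B \<phi> \<one>\<^bsub>alg_tensor A\<^esub> = \<one>\<^bsub>alg_tensor B\<^esub>"
      unfolding ring_hom_one[OF A_hom, symmetric] ring_hom_one[OF B_hom, symmetric]
        map_coset[OF MA.one_closed]
      by (simp add: f1alg_hom_monoid_hom(2)[OF \<phi>])
  qed
  moreover have "alg_tensor_map A B \<phi> \<in> extensional (carrier (alg_tensor A))"
    unfolding alg_tensor_map_def by (rule restrict_extensional)
  ultimately show ?thesis
    unfolding cring_hom_def by (rule IntI)
qed

lemma gset_comp_truncate: "gset_comp (gset.truncate A) = gset_comp A"
  and gset_id_truncate: "gset_id (gset.truncate A) = gset_id A"
  by (simp_all add: fun_eq_iff gset_comp_def gset_id_def)

lemma functor_alg_tensor: "cat_functor F1Alg CRing alg_tensor alg_tensor_map"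
proof (intro cat_functor.intro cat_functor_axioms.intro category_F1Alg category_CRing, goal_cases)
  case (3 A)
  then have A: "commutative_f1_algebra A" by (simp add: F1Alg_def)
  show ?case
    using mod_tensor_map_id[OF gamma_set_truncate[OF commutative_f1_algebra_gamma_set[OF A]]]
    by (simp add: F1Alg_def CRing_def alg_tensor_map_eq A gset_id_truncate carrier_alg_tensor)
next
  case (4 A B C \<phi> \<psi>)
  then have *: "commutative_f1_algebra A" "commutative_f1_algebra B" "commutative_f1_algebra C"
    "\<phi> \<in> gset_hom A B" "\<psi> \<in> gset_hom B C"
    by (simp_all add: F1Alg_def f1alg_hom_gset_hom)
  then show ?case
    using mod_tensor_map_comp[of "gset.truncate A" "gset.truncate B" "gset.truncate C" \<phi> \<psi>]
    by (simp add: F1Alg_def CRing_def alg_tensor_map_eq gset_comp_truncate carrier_alg_tensor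
        gset_hom_truncate gamma_set_truncate commutative_f1_algebra_gamma_set)
qed (auto simp: F1Alg_def CRing_def cring_alg_tensor alg_tensor_map_hom)

section \<open>Eilenberg-MacLane algebras\<close>

lemma smash_fst_mem:
  assumes "k \<in> {1..m * n}"
  shows "smash_fst n k \<in> {1..m}"
proof -
  have "k - 1 < m * n" using assms by auto
  then have "(k - 1) div n < m" by (rule less_mult_imp_div_less)
  then show ?thesis by (simp add: smash_fst_def)
qed

lemma smash_snd_mem:
  assumes "k \<in> {1..m * n}"
  shows "smash_snd n k \<in> {1..n}"
proof -
  have "n > 0" using assms by (cases n) auto
  then have "(k - 1) mod n < n" by simp
  then show ?thesis by (simp add: smash_snd_def)
qed

lemma smash_pair_mem:
  assumes "i \<in> {1..m}" "j \<in> {1..n}"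
  shows "smash_pair n i j \<in> {1..m * n}"
proof -
  have "(i - 1) * n + n = i * n"
    using assms(1) by (cases i) auto
  also have "i * n \<le> m * n"
    using assms(1) by simp
  finally show ?thesis
    using assms by (auto simp: smash_pair_def)
qed

text \<open>With \<open>smash_pair_fst_snd\<close> this makes \<open>smash_pair n\<close> a
  bijection from \<open>{1..m} \<times> {1..n}\<close> to \<open>{1..m * n}\<close>; the shifts by
  one keep \<open>0\<close> free for the basepoint.\<close>

lemma smash_fst_snd_pair:
  assumes "1 \<le> i" "j \<in> {1..n}"
  shows "smash_fst n (smash_pair n i j) = i" "smash_snd n (smash_pair n i j) = j"
proof -
  obtain a b where "i = Suc a" "j = Suc b" "b < n"
    using assms by (cases i; cases j) auto
  then show "smash_fst n (smash_pair n i j) = i" "smash_snd n (smash_pair n i j) = j"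
    by (simp_all add: smash_pair_def smash_fst_def smash_snd_def)
qed

lemma smash_pair_fst_snd: "1 \<le> k \<Longrightarrow> smash_pair n (smash_fst n k) (smash_snd n k) = k"
  using div_mult_mod_eq[of "k - 1" n] by (simp add: smash_pair_def smash_fst_def smash_snd_def)

text \<open>As \<open>j\<close> is not the basepoint, neither coordinate of \<open>k\<close> may be
  sent to \<open>0\<close>, and \<open>smash_pair\<close> is injective on nonzero indices. Fibres of
  a smash of maps are thus products of fibres.\<close>

lemma smash_map_eq_iff:
  assumes f: "f \<in> gamma_maps m m'" and g: "g \<in> gamma_maps n n'"
    and k: "k \<in> {1..m * n}" and j: "j \<in> {1..m' * n'}"
  shows "smash_map m n n' f g k = j \<longleftrightarrow>
    f (smash_fst n k) = smash_fst n' j \<and> g (smash_snd n k) = smash_snd n' j"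
proof
  have eq: "smash_map m n n' f g k = smash_pair n' (f (smash_fst n k)) (g (smash_snd n k))"
    using k by (auto simp: smash_map_def)
  show "smash_map m n n' f g k = j"
    if "f (smash_fst n k) = smash_fst n' j \<and> g (smash_snd n k) = smash_snd n' j"
    using that eq smash_pair_fst_snd[of j n'] j by simp
  assume *: "smash_map m n n' f g k = j"
  then have nz: "f (smash_fst n k) \<noteq> 0" "g (smash_snd n k) \<noteq> 0"
    using eq j by (auto simp: smash_pair_def split: if_splits)
  have "g (smash_snd n k) \<le> n'"
    using g smash_snd_mem[OF k] by (auto simp: gamma_maps_def PiE_iff)
  then show "f (smash_fst n k) = smash_fst n' j \<and> g (smash_snd n k) = smash_snd n' j"
    using * eq nz smash_fst_snd_pair[of "f (smash_fst n k)" "g (smash_snd n k)" n'] by auto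
qed

lemma (in cring) finsum_mult_finsum:
  assumes "finite A" "finite B" "x \<in> A \<rightarrow> carrier R" "y \<in> B \<rightarrow> carrier R"
  shows "(\<Oplus>i\<in>A. x i) \<otimes> (\<Oplus>j\<in>B. y j) = (\<Oplus>p\<in>A \<times> B. x (fst p) \<otimes> y (snd p))"
  using assms(1,3)
proof (induction A rule: finite_induct)
  case empty
  then show ?case using assms by simp
next
  case (insert a A)
  \<comment> \<open>The row of \<open>a\<close> is split off as the image of \<open>B\<close> under
    \<open>Pair a\<close>, along which its sum is reindexed.\<close>
  have "insert a A \<times> B = Pair a ` B \<union> A \<times> B" by auto
  moreover have "(\<Oplus>p\<in>Pair a ` B. x (fst p) \<otimes> y (snd p)) = (\<Oplus>j\<in>B. x a \<otimes> y j)"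
    using insert assms by (subst finsum_reindex) (auto simp: inj_on_def Pi_iff)
  moreover have "(\<Oplus>j\<in>B. x a \<otimes> y j) = x a \<otimes> (\<Oplus>j\<in>B. y j)"
    using insert assms by (subst finsum_rdistr) (auto simp: Pi_iff)
  moreover have "(\<Oplus>p\<in>Pair a ` B \<union> A \<times> B. x (fst p) \<otimes> y (snd p)) =
    (\<Oplus>p\<in>Pair a ` B. x (fst p) \<otimes> y (snd p)) \<oplus> (\<Oplus>p\<in>A \<times> B. x (fst p) \<otimes> y (snd p))"
    using insert assms by (intro finsum_Un_disjoint) (auto simp: Pi_iff)
  ultimately show ?case
    using insert assms by (simp add: l_distr Pi_iff)
qed

section \<open>The algebra axioms for \<open>EM R\<close>\<close>

lemma EM_simps [simp]:
  "gobj (EM R) n = {1..n} \<rightarrow>\<^sub>E carrier R"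
  "gbase (EM R) n = (\<lambda>i\<in>{1..n}. \<zero>\<^bsub>R\<^esub>)"
  "gmap (EM R) n k f r = (\<lambda>j\<in>{1..k}. \<Oplus>\<^bsub>R\<^esub>i\<in>{i \<in> {1..n}. f i = j}. r i)"
  "gmul (EM R) m n x y = (\<lambda>k\<in>{1..m * n}. x (smash_fst n k) \<otimes>\<^bsub>R\<^esub> y (smash_snd n k))"
  "gunit (EM R) = (\<lambda>i\<in>{1..1}. \<one>\<^bsub>R\<^esub>)"
  by (simp_all add: EM_def)

lemma EM_gmap_apply:
  "j \<in> {1..k} \<Longrightarrow> gmap (EM R) n k f r j = (\<Oplus>\<^bsub>R\<^esub>i\<in>{i \<in> {1..n}. f i = j}. r i)"
  by simp

lemma gamma_set_EM:
  fixes R :: "'r ring" (structure)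
  assumes "cring R"
  shows "gamma_set (EM R)"
proof -
  interpret cring R by fact
  show ?thesis
  proof (unfold_locales, goal_cases)
    case (1 n)
    then show ?case by auto
  next
    case (2 f m n x)
    then show ?case by (auto intro!: finsum_closed)
  next
    case (3 f m n)
    then show ?case by (auto intro!: restrict_ext add.finprod_one_eqI)
  next
    case (4 x n)
    show ?case
    proof (rule extensionalityI)
      fix j assume j: "j \<in> {1..n}"
      then have "{i \<in> {1..n}. (\<lambda>i\<in>{..n}. i) i = j} = {j}" by auto
      then show "gmap (EM R) n n (\<lambda>i\<in>{..n}. i) x j = x j"
        using 4 j by (auto simp: PiE_iff)
    qed (use 4 in \<open>auto simp: PiE_iff\<close>)
  next
    case (5 f l m g n x)
    show ?case
    proof (rule extensionalityI)
      fix j assume j: "j \<in> {1..n}"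
      let ?K = "{k \<in> {1..m}. g k = j}"
      \<comment> \<open>Since \<open>g 0 = 0\<close> while \<open>j \<ge> 1\<close>, no index in
        this fibre is sent to \<open>0\<close> by \<open>f\<close>. The fibre of the composite is
        then a disjoint union of fibres of \<open>f\<close> over nonzero points, and the sum can be
        regrouped.\<close>
      have eq: "{i \<in> {1..l}. compose {..l} g f i = j} = (\<Union>k\<in>?K. {i \<in> {1..l}. f i = k})"
      proof -
        have "f i \<in> ?K" if "i \<in> {1..l}" "g (f i) = j" for i
        proof -
          have "f i \<le> m" "g 0 = 0"
            using 5(1,2) that by (auto simp: gamma_maps_def PiE_iff)
          moreover have "f i \<noteq> 0"
            using that j \<open>g 0 = 0\<close> by (metis atLeastAtMost_iff not_one_le_zero)
          ultimately show ?thesis using that by simp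
        qed
        then show ?thesis
          by (auto simp: compose_def)
      qed
      have "(\<Oplus>i\<in>(\<Union>k\<in>?K. {i \<in> {1..l}. f i = k}). x i) =
        (\<Oplus>k\<in>?K. \<Oplus>i\<in>{i \<in> {1..l}. f i = k}. x i)"
        using 5(3) by (intro add.finprod_UN_disjoint) (auto simp: pairwise_def disjnt_def PiE_iff)
      also have "\<dots> = (\<Oplus>k\<in>?K. gmap (EM R) l m f x k)"
        using 5(3) by (intro finsum_cong') (auto simp: PiE_iff intro!: finsum_closed)
      finally show "gmap (EM R) l n (compose {..l} g f) x j = gmap (EM R) m n g (gmap (EM R) l m f x) j"
        unfolding EM_gmap_apply[OF j] eq .
    qed auto
  next
    case 6
    show ?case by auto
  qed
qed

text \<open>In coordinate \<open>j\<close> the left side is a product of two fibre sums, which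
  expands into a sum over pairs; the fibre of the smash map is in bijection with these
  pairs.\<close>

lemma EM_gmul_natural:
  fixes R :: "'r ring" (structure)
  assumes "cring R" and f: "f \<in> gamma_maps m m'" and g: "g \<in> gamma_maps n n'"
    and x: "x \<in> {1..m} \<rightarrow>\<^sub>E carrier R" and y: "y \<in> {1..n} \<rightarrow>\<^sub>E carrier R"
  shows "gmul (EM R) m' n' (gmap (EM R) m m' f x) (gmap (EM R) n n' g y)
    = gmap (EM R) (m * n) (m' * n') (smash_map m n n' f g) (gmul (EM R) m n x y)"
proof (rule extensionalityI)
  interpret cring R by fact
  fix j assume j: "j \<in> {1..m' * n'}"
  let ?A = "{i \<in> {1..m}. f i = smash_fst n' j}" and ?B = "{i \<in> {1..n}. g i = smash_snd n' j}"
    and ?K = "{k \<in> {1..m * n}. smash_map m n n' f g k = j}"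
    and ?h = "\<lambda>k. (smash_fst n k, smash_snd n k)"
  have K: "?K = {k \<in> {1..m * n}. f (smash_fst n k) = smash_fst n' j \<and> g (smash_snd n k) = smash_snd n' j}"
    using smash_map_eq_iff[OF f g _ j] by blast
  have h: "?h ` ?K = ?A \<times> ?B"
  proof
    show "?h ` ?K \<subseteq> ?A \<times> ?B"
      unfolding K using smash_fst_mem smash_snd_mem by blast
    show "?A \<times> ?B \<subseteq> ?h ` ?K"
    proof clarify
      fix i l assume i: "i \<in> {1..m}" "f i = smash_fst n' j" and l: "l \<in> {1..n}" "g l = smash_snd n' j"
      have "?h (smash_pair n i l) = (i, l)"
        using smash_fst_snd_pair[of i l n] i l by simp
      moreover have "smash_pair n i l \<in> ?K"
        unfolding K using smash_pair_mem[OF i(1) l(1)] calculation i l by simp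
      ultimately show "(i, l) \<in> ?h ` ?K" by (metis (no_types, lifting) image_eqI)
    qed
  qed
  have inj: "inj_on ?h ?K"
    by (rule inj_onI) (metis (no_types, lifting) Pair_inject atLeastAtMost_iff mem_Collect_eq smash_pair_fst_snd)
  have closed: "(\<lambda>p. x (fst p) \<otimes> y (snd p)) \<in> ?h ` ?K \<rightarrow> carrier R"
    unfolding h using x y by (auto simp: PiE_iff)
  have "gmul (EM R) m' n' (gmap (EM R) m m' f x) (gmap (EM R) n n' g y) j =
    (\<Oplus>i\<in>?A. x i) \<otimes> (\<Oplus>i\<in>?B. y i)"
    using j smash_fst_mem[OF j] smash_snd_mem[OF j] by simp
  also have "\<dots> = (\<Oplus>p\<in>?h ` ?K. x (fst p) \<otimes> y (snd p))"
    unfolding h using x y by (intro finsum_mult_finsum) auto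
  also have "\<dots> = (\<Oplus>k\<in>?K. x (smash_fst n k) \<otimes> y (smash_snd n k))"
    using finsum_reindex[OF closed inj] by simp
  also have "\<dots> = (\<Oplus>k\<in>?K. gmul (EM R) m n x y k)"
    using x y smash_fst_mem smash_snd_mem by (intro finsum_cong') (auto simp: PiE_iff)
  finally show "gmul (EM R) m' n' (gmap (EM R) m m' f x) (gmap (EM R) n n' g y) j =
      gmap (EM R) (m * n) (m' * n') (smash_map m n n' f g) (gmul (EM R) m n x y) j"
    unfolding EM_gmap_apply[OF j] .
qed auto

text \<open>The swap permutes the nonzero indices, so each fibre sum has exactly one term and the
  claim becomes commutativity of \<open>R\<close>.\<close>

lemma EM_gmul_commute:
  fixes R :: "'r ring" (structure)
  assumes "cring R" and x: "x \<in> {1..m} \<rightarrow>\<^sub>E carrier R" and y: "y \<in> {1..n} \<rightarrow>\<^sub>E carrier R"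
  shows "gmap (EM R) (m * n) (n * m) (smash_swap m n) (gmul (EM R) m n x y) = gmul (EM R) n m y x"
proof (rule extensionalityI)
  interpret cring R by fact
  fix j assume j: "j \<in> {1..n * m}"
  let ?k = "smash_pair n (smash_snd m j) (smash_fst m j)"
  note fj = smash_fst_mem[OF j] and sj = smash_snd_mem[OF j]
  have k: "smash_fst n ?k = smash_snd m j" "smash_snd n ?k = smash_fst m j" "?k \<in> {1..m * n}"
    using smash_fst_snd_pair[of "smash_snd m j" "smash_fst m j" n] smash_pair_mem[OF sj fj] fj sj
    by simp_all
  have "i = ?k" if i: "i \<in> {1..m * n}" "smash_swap m n i = j" for i
  proof -
    have "j = smash_pair m (smash_snd n i) (smash_fst n i)"
      using i by (auto simp: smash_swap_def split: if_splits)
    then show ?thesis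
      using smash_fst_snd_pair[of "smash_snd n i" "smash_fst n i" m] smash_pair_fst_snd[of i n]
        smash_fst_mem[OF i(1)] smash_snd_mem[OF i(1)] i(1) by simp
  qed
  moreover have "smash_swap m n ?k = j"
    using k smash_pair_fst_snd[of j m] j by (simp add: smash_swap_def)
  ultimately have K: "{i \<in> {1..m * n}. smash_swap m n i = j} = {?k}"
    using k(3) by blast
  have "gmul (EM R) m n x y ?k = gmul (EM R) n m y x j" "gmul (EM R) m n x y ?k \<in> carrier R"
    using k j fj sj x y by (auto simp: PiE_iff m_comm)
  then show "gmap (EM R) (m * n) (n * m) (smash_swap m n) (gmul (EM R) m n x y) j = gmul (EM R) n m y x j"
    unfolding EM_gmap_apply[OF j] K by simp
qed auto

lemma commutative_f1_algebra_EM: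
  fixes R :: "'r ring" (structure)
  assumes "cring R"
  shows "commutative_f1_algebra (EM R)"
proof -
  interpret cring R by fact
  interpret gamma_set "EM R" by (rule gamma_set_EM) fact
  show ?thesis
  proof (unfold_locales, goal_cases)
    case (1 x m y n)
    then show ?case
      using smash_fst_mem smash_snd_mem by (auto simp: PiE_iff)
  next
    case (2 y n m)
    then show ?case
      using smash_fst_mem smash_snd_mem by (auto simp: PiE_iff intro!: restrict_ext)
  next
    case (3 x m n)
    then show ?case
      using smash_fst_mem smash_snd_mem by (auto simp: PiE_iff intro!: restrict_ext)
  next
    case (4 f m m' g n n' x y)
    then show ?case
      using EM_gmul_natural[OF assms] by (simp only: EM_simps(1))
  next
    case 5
    show ?case by auto
  next
    case (6 x l y m z n)
    show ?case
    proof (rule extensionalityI)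
      fix k assume k: "k \<in> {1..l * m * n}"
      then have k': "k \<in> {1..l * (m * n)}" by (simp add: mult.assoc)
      \<comment> \<open>The two bracketings decode \<open>k\<close> into the same three coordinates;
        these equations reduce the claim to associativity in \<open>R\<close>.\<close>
      have "smash_fst m (smash_fst n k) = smash_fst (m * n) k"
        by (simp add: smash_fst_def div_mult2_eq mult.commute[of m n])
      moreover have "smash_snd m (smash_fst n k) = smash_fst n (smash_snd (m * n) k)"
        using k by (cases "n = 0")
          (simp_all add: smash_fst_def smash_snd_def mod_mult2_eq mult.commute[of m n])
      moreover have "smash_snd n (smash_snd (m * n) k) = smash_snd n k"
        by (simp add: smash_snd_def mod_mult_right_eq mod_mod_cancel)
      ultimately show "gmul (EM R) (l * m) n (gmul (EM R) l m x y) z k =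
        gmul (EM R) l (m * n) x (gmul (EM R) m n y z) k"
        using k k' 6 smash_fst_mem[OF k] smash_snd_mem[OF k] smash_fst_mem[OF k'] smash_snd_mem[OF k']
          smash_fst_mem[OF smash_fst_mem[OF k]] smash_snd_mem[OF smash_fst_mem[OF k]]
        by (simp add: PiE_iff m_assoc)
    qed (simp_all only: EM_simps mult.assoc restrict_extensional)
  next
    case (7 x n)
    show ?case
    proof (rule extensionalityI)
      fix k assume k: "k \<in> {1..n}"
      then have "smash_fst n k = 1" "smash_snd n k = k"
        by (auto simp: smash_fst_def smash_snd_def)
      then show "gmul (EM R) 1 n (gunit (EM R)) x k = x k"
        using 7 k by (auto simp: PiE_iff)
    qed (use 7 in \<open>auto simp: PiE_iff\<close>)
  next
    case (8 x n)
    show ?case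
    proof (rule extensionalityI)
      fix k assume k: "k \<in> {1..n}"
      then have "smash_fst 1 k = k" "smash_snd 1 k = 1"
        by (auto simp: smash_fst_def smash_snd_def)
      then show "gmul (EM R) n 1 x (gunit (EM R)) k = x k"
        using 8 k by (auto simp: PiE_iff)
    qed (use 8 in \<open>auto simp: PiE_iff\<close>)
  next
    case (9 x m y n)
    then show ?case
      using EM_gmul_commute[OF assms] by (simp only: EM_simps(1))
  qed
qed

section \<open>Functoriality of \<open>EM\<close>\<close>

lemma EM_map_apply: "\<lbrakk>x \<in> {1..n} \<rightarrow>\<^sub>E carrier R; i \<in> {1..n}\<rbrakk> \<Longrightarrow> EM_map R S h n x i = h (x i)"
  by (simp add: EM_map_def)

text \<open>A ring homomorphism commutes with the finite sums in \<open>gmap\<close> and with the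
  products in \<open>gmul\<close>, coordinate by coordinate.\<close>

lemma EM_map_hom:
  fixes R :: "'r ring" (structure)
  assumes "cring R" "cring S" "h \<in> cring_hom R S"
  shows "EM_map R S h \<in> f1alg_hom (EM R) (EM S)"
proof -
  interpret ring_hom_cring R S h
    using assms by (intro ring_hom_cringI ring_hom_ringI2) (auto simp: cring_hom_def cring_def)
  have ext: "EM_map R S h n x \<in> {1..n} \<rightarrow>\<^sub>E carrier S" if "x \<in> {1..n} \<rightarrow>\<^sub>E carrier R" for n x
    using that by (auto simp: EM_map_def PiE_iff)
  interpret E: commutative_f1_algebra "EM R"
    by (rule commutative_f1_algebra_EM) fact
  have "EM_map R S h n (gmap (EM R) m n f x) = gmap (EM S) m n f (EM_map R S h m x)"
    if f: "f \<in> gamma_maps m n" and x: "x \<in> gobj (EM R) m" for m n f x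
  proof (rule extensionalityI)
    fix j assume j: "j \<in> {1..n}"
    have "EM_map R S h n (gmap (EM R) m n f x) j = h (\<Oplus>i\<in>{i \<in> {1..m}. f i = j}. x i)"
      using E.gmap_closed[OF f x] j by (simp only: EM_simps(1) EM_map_apply) simp
    also have "\<dots> = (\<Oplus>\<^bsub>S\<^esub>i\<in>{i \<in> {1..m}. f i = j}. h (x i))"
      using x by (subst hom_finsum) (auto simp: o_def)
    also have "\<dots> = (\<Oplus>\<^bsub>S\<^esub>i\<in>{i \<in> {1..m}. f i = j}. EM_map R S h m x i)"
      using x by (intro S.finsum_cong') (auto simp: EM_map_apply PiE_iff)
    finally show "EM_map R S h n (gmap (EM R) m n f x) j = gmap (EM S) m n f (EM_map R S h m x) j"
      using j by simp
  qed (use ext[OF E.gmap_closed[OF f x, unfolded EM_simps(1)]] in \<open>simp_all add: PiE_iff\<close>)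
  moreover have "EM_map R S h (m * n) (gmul (EM R) m n x y) =
      gmul (EM S) m n (EM_map R S h m x) (EM_map R S h n y)"
    if x: "x \<in> gobj (EM R) m" and y: "y \<in> gobj (EM R) n" for m n x y
  proof (rule extensionalityI)
    fix k assume k: "k \<in> {1..m * n}"
    show "EM_map R S h (m * n) (gmul (EM R) m n x y) k =
      gmul (EM S) m n (EM_map R S h m x) (EM_map R S h n y) k"
      using k E.gmul_closed[OF x y] smash_fst_mem[OF k] smash_snd_mem[OF k] x y
      by (simp add: EM_map_apply) (simp add: PiE_iff)
  qed (use ext[OF E.gmul_closed[OF x y, unfolded EM_simps(1)]] in \<open>simp_all add: PiE_iff\<close>)
  moreover have "EM_map R S h n (gbase (EM R) n) = gbase (EM S) n" for n
    using E.gbase_closed[of n] by (auto simp: EM_map_def intro!: restrict_ext)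
  moreover have "EM_map R S h 1 (gunit (EM R)) = gunit (EM S)"
    using E.gunit_closed by (auto simp: EM_map_def intro!: restrict_ext)
  moreover have "EM_map R S h n \<in> gobj (EM R) n \<rightarrow>\<^sub>E gobj (EM S) n" for n
    using ext by (auto simp: EM_map_def)
  ultimately show ?thesis
    unfolding f1alg_hom_def gset_hom_def by blast
qed

lemma EM_map_id: "EM_map R R (\<lambda>r\<in>carrier R. r) = gset_id (EM R)"
proof (rule ext, rule ext)
  fix n x
  show "EM_map R R (\<lambda>r\<in>carrier R. r) n x = gset_id (EM R) n x"
  proof (cases "x \<in> {1..n} \<rightarrow>\<^sub>E carrier R")
    case True
    then have "(\<lambda>i\<in>{1..n}. (\<lambda>r\<in>carrier R. r) (x i)) = x"
      by (intro extensionalityI[where A="{1..n}"]) (auto simp: PiE_iff)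
    then show ?thesis
      using True by (simp add: EM_map_def gset_id_def)
  qed (simp add: EM_map_def gset_id_def)
qed

lemma EM_map_comp:
  assumes "f \<in> carrier R \<rightarrow> carrier S"
  shows "EM_map R T (compose (carrier R) g f) = gset_comp (EM R) (EM_map S T g) (EM_map R S f)"
proof (rule ext, rule ext)
  fix n x
  show "EM_map R T (compose (carrier R) g f) n x = gset_comp (EM R) (EM_map S T g) (EM_map R S f) n x"
  proof (cases "x \<in> {1..n} \<rightarrow>\<^sub>E carrier R")
    case True
    then have "EM_map R S f n x \<in> {1..n} \<rightarrow>\<^sub>E carrier S"
      using assms by (auto simp: EM_map_def PiE_iff)
    then show ?thesis
      using True
      by (auto simp: EM_map_def gset_comp_def compose_def PiE_iff intro!: restrict_ext)
  qed (simp add: EM_map_def gset_comp_def compose_def)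
qed

lemma functor_EM: "cat_functor CRing F1Alg EM EM_map"
proof (intro cat_functor.intro cat_functor_axioms.intro category_F1Alg category_CRing, goal_cases)
  case (4 R S T f g)
  then have "f \<in> carrier R \<rightarrow> carrier S"
    by (simp add: CRing_def cring_hom_def ring_hom_def)
  then show ?case
    by (simp add: CRing_def F1Alg_def EM_map_comp)
qed (simp_all add: CRing_def F1Alg_def commutative_f1_algebra_EM EM_map_hom EM_map_id)

section \<open>The adjunction\<close>

lemma ring_hom_monoid_ring_diff:
  fixes R (structure)
  assumes "ring R" "G \<in> ring_hom (monoid_ring M) R"
    and a: "Poly_Mapping.keys a \<subseteq> carrier M" and b: "Poly_Mapping.keys b \<subseteq> carrier M"
  shows "G (a - b) = G a \<ominus> G b"
proof -
  interpret ring R by fact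
  have ab: "a - b \<in> carrier (monoid_ring M)"
    using keys_diff_subset[OF a b] by simp
  \<comment> \<open>The difference is that of finitely supported functions, so its image is
    recovered from additivity and \<open>(a - b) + b = a\<close>.\<close>
  have "G ((a - b) \<oplus>\<^bsub>monoid_ring M\<^esub> b) = G (a - b) \<oplus> G b"
    using assms(2) ab b by (intro ring_hom_add) auto
  then have "G a = G (a - b) \<oplus> G b" by simp
  moreover have "G (a - b) \<in> carrier R" "G b \<in> carrier R"
    using ring_hom_closed[OF assms(2)] ab b by auto
  ultimately show ?thesis
    by (simp add: minus_eq a_assoc r_neg)
qed

lemma ring_hom_monoid_ring_eqI:
  assumes "ring R" "G \<in> ring_hom (monoid_ring M) R" "H \<in> ring_hom (monoid_ring M) R"
    and "ring (monoid_ring M)"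
    and eq: "\<And>a. a \<in> carrier M \<Longrightarrow> G (frag_of a) = H (frag_of a)"
    and c: "c \<in> carrier (monoid_ring M)"
  shows "G c = H c"
proof -
  have "Poly_Mapping.keys c \<subseteq> carrier M" using c by simp
  \<comment> \<open>The support is part of the induction claim because the difference step supplies
    only the claim for \<open>a\<close> and \<open>b\<close>, and the rule for images of differences
    asks for their supports.\<close>
  then have "Poly_Mapping.keys c \<subseteq> carrier M \<and> G c = H c"
  proof (induction rule: frag_induction)
    case zero
    show ?case
      using ring_hom_zero[OF assms(2,4,1)] ring_hom_zero[OF assms(3,4,1)] by simp
  next
    case (one a)
    then show ?case using eq by simp
  next
    case (diff a b)
    then show ?case
      using ring_hom_monoid_ring_diff[OF assms(1,2)] ring_hom_monoid_ring_diff[OF assms(1,3)]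
        keys_diff_subset[of a _ b] by simp
  qed
  then show ?thesis by simp
qed

text \<open>The additive extension exists by freeness. Its multiplicativity is reached one factor at
  a time: generator by generator, generator by \<open>d\<close>, then \<open>c\<close> by
  \<open>d\<close>.\<close>

lemma ring_hom_monoid_ring_lift:
  fixes R (structure)
  assumes "cring R" and f: "f \<in> hom M R" "f \<one>\<^bsub>M\<^esub> = \<one>" and M: "Group.monoid M"
  obtains h where "h \<in> ring_hom (monoid_ring M) R" "\<And>a. a \<in> carrier M \<Longrightarrow> h (frag_of a) = f a"
proof -
  interpret cring R by fact
  have "f ` carrier M \<subseteq> carrier (add_monoid R)"
    using f(1) by (auto simp: hom_def)
  then obtain h where h: "h \<in> hom (free_Abelian_group (carrier M)) (add_monoid R)"
    and h_of: "\<And>a. a \<in> carrier M \<Longrightarrow> h (frag_of a) = f a"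
    using comm_group.free_Abelian_group_universal[OF a_comm_group] by metis
  have closed: "h c \<in> carrier R" if "Poly_Mapping.keys c \<subseteq> carrier M" for c
    using h that by (auto simp: hom_def)
  have add: "h (c + d) = h c \<oplus> h d"
    if "Poly_Mapping.keys c \<subseteq> carrier M" "Poly_Mapping.keys d \<subseteq> carrier M" for c d
    using hom_mult[OF h, of c d] that by simp
  have h_diff: "h (c - d) = h c \<ominus> h d"
    if c: "Poly_Mapping.keys c \<subseteq> carrier M" and d: "Poly_Mapping.keys d \<subseteq> carrier M" for c d
  proof -
    have "h c = h (c - d) \<oplus> h d"
      using add[OF keys_diff_subset[OF c d] d] by simp
    then show ?thesis
      using closed[OF keys_diff_subset[OF c d]] closed[OF d] by (simp add: minus_eq a_assoc r_neg)
  qed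
  have h_zero: "h 0 = \<zero>"
    using hom_one[OF h group_free_Abelian_group a_group] by simp
  note M_closed = monoid_ring_mult_closed[OF M]
  have mult: "h (c \<otimes>\<^bsub>monoid_ring M\<^esub> d) = h c \<otimes> h d"
    if c: "Poly_Mapping.keys c \<subseteq> carrier M" and d: "Poly_Mapping.keys d \<subseteq> carrier M" for c d
  proof -
    have of: "h (frag_of a \<otimes>\<^bsub>monoid_ring M\<^esub> d) = h (frag_of a) \<otimes> h d" if a: "a \<in> carrier M" for a
    proof -
      have "Poly_Mapping.keys d \<subseteq> carrier M \<and>
        h (frag_of a \<otimes>\<^bsub>monoid_ring M\<^esub> d) = h (frag_of a) \<otimes> h d"
        using d
      proof (induction rule: frag_induction)
        case zero
        show ?case using a closed by (simp add: h_zero)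
      next
        case (one b)
        then show ?case
          using a hom_mult[OF f(1) a one] Group.monoid.m_closed[OF M a one] by (simp add: h_of)
      next
        case (diff p q)
        then show ?case
          using a closed M_closed[of "frag_of a"] h_diff
          by (simp add: monoid_ring_distrib keys_diff_subset minus_eq r_distr r_minus)
      qed
      then show ?thesis ..
    qed
    have "Poly_Mapping.keys c \<subseteq> carrier M \<and> h (c \<otimes>\<^bsub>monoid_ring M\<^esub> d) = h c \<otimes> h d"
      using c
    proof (induction rule: frag_induction)
      case zero
      show ?case using d closed by (simp add: h_zero)
    next
      case (one a)
      then show ?case using of by simp
    next
      case (diff p q)
      then show ?case
        using d closed M_closed[of _ d] h_diff
        by (simp add: monoid_ring_distrib keys_diff_subset minus_eq l_distr l_minus)
    qed
    then show ?thesis ..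
  qed
  have "h \<in> ring_hom (monoid_ring M) R"
    using closed mult add by (intro ring_hom_memI) (simp_all add: h_of f(2) Group.monoid.one_closed[OF M])
  then show thesis
    using that h_of by blast
qed

text \<open>Factoring through the quotient group gives an additive \<open>g\<close>; as it takes the
  values of \<open>h\<close> on representatives, it inherits products and the unit.\<close>

lemma ring_hom_Quot_lift:
  assumes "ideal I R" "ring S" "h \<in> ring_hom R S" "I \<subseteq> a_kernel R S h"
  obtains g where "g \<in> ring_hom (R Quot I) S" "\<And>x. x \<in> carrier R \<Longrightarrow> g (I +>\<^bsub>R\<^esub> x) = h x"
proof -
  interpret ideal I R by fact
  interpret h: ring_hom_ring R S h
    using assms(2,3) by (intro ring_hom_ringI2 ring_axioms)
  interpret gh: group_hom "add_monoid R" "add_monoid S" h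
    by (rule h.a_group_hom)
  have "I \<lhd> add_monoid R"
    using a_normal .
  then obtain g where g: "g \<in> hom (add_monoid R Mod I) (add_monoid S)"
    and g_coset: "\<And>x. x \<in> carrier R \<Longrightarrow> g (I +>\<^bsub>R\<^esub> x) = h x"
    using gh.FactGroup_universal_kernel[of I] assms(4)
    unfolding a_kernel_def a_r_coset_def by (metis partial_object.select_convs(1))
  have rep: "\<exists>x\<in>carrier R. X = I +>\<^bsub>R\<^esub> x" if "X \<in> carrier (R Quot I)" for X
    using that unfolding FactRing_def A_RCOSETS_def' by auto
  note coset = rcos_ring_hom
  have "g \<in> ring_hom (R Quot I) S"
  proof (rule ring_hom_memI)
    fix X assume "X \<in> carrier (R Quot I)"
    then show "g X \<in> carrier S"
      using rep g_coset h.hom_closed by metis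
  next
    fix X Y assume X: "X \<in> carrier (R Quot I)" and Y: "Y \<in> carrier (R Quot I)"
    obtain x where x: "x \<in> carrier R" "X = I +>\<^bsub>R\<^esub> x" using rep[OF X] by blast
    obtain y where y: "y \<in> carrier R" "Y = I +>\<^bsub>R\<^esub> y" using rep[OF Y] by blast
    show "g (X \<otimes>\<^bsub>R Quot I\<^esub> Y) = g X \<otimes>\<^bsub>S\<^esub> g Y"
      unfolding x(2) y(2) ring_hom_mult[OF coset x(1) y(1), symmetric]
      using x(1) y(1) by (simp add: g_coset)
    show "g (X \<oplus>\<^bsub>R Quot I\<^esub> Y) = g X \<oplus>\<^bsub>S\<^esub> g Y"
      unfolding x(2) y(2) ring_hom_add[OF coset x(1) y(1), symmetric]
      using x(1) y(1) by (simp add: g_coset)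
  next
    show "g \<one>\<^bsub>R Quot I\<^esub> = \<one>\<^bsub>S\<^esub>"
      unfolding ring_hom_one[OF coset, symmetric] by (simp add: g_coset)
  qed
  then show thesis
    using that g_coset by blast
qed

section \<open>Ring homomorphisms out of the tensor product\<close>

abbreviation alg_gen :: "'a f1alg \<Rightarrow> 'a \<Rightarrow> ('a \<Rightarrow>\<^sub>0 int) set" where
  "alg_gen A a \<equiv> alg_coset A (frag_of a)"

text \<open>The classes of generators span the ring additively, since every element is the coset of
  an integer combination of generators.\<close>

lemma alg_tensor_hom_eqI:
  assumes A: "commutative_f1_algebra A" and R: "cring R"
    and g: "g \<in> cring_hom (alg_tensor A) R" and h: "h \<in> cring_hom (alg_tensor A) R"
    and eq: "\<And>a. a \<in> gobj A 1 \<Longrightarrow> g (alg_gen A a) = h (alg_gen A a)"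
  shows "g = h"
proof (rule extensionalityI)
  let ?M = "monoid_ring (f1alg_monoid A)"
  interpret M: cring ?M
    by (rule cring_monoid_ring[OF comm_monoid_f1alg_monoid[OF A]])
  interpret R: cring R by fact
  show "g \<in> extensional (carrier (alg_tensor A))" "h \<in> extensional (carrier (alg_tensor A))"
    using g h by (simp_all add: cring_hom_def)
  fix C assume "C \<in> carrier (alg_tensor A)"
  then obtain c where c: "c \<in> carrier ?M" "C = alg_coset A c"
    by (rule alg_tensor_carrierE)
  have "(g \<circ> alg_coset A) \<in> ring_hom ?M R" "(h \<circ> alg_coset A) \<in> ring_hom ?M R"
    using ring_hom_trans[OF alg_coset_hom[OF A]] g h by (auto simp: cring_hom_def)
  then have "(g \<circ> alg_coset A) c = (h \<circ> alg_coset A) c"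
    by (rule ring_hom_monoid_ring_eqI[OF R.ring_axioms _ _ M.ring_axioms])
      (use eq c(1) in simp_all)
  then show "g C = h C"
    by (simp add: c(2))
qed

text \<open>
  By the universal properties of the monoid ring and of the quotient, ring homomorphisms out of
  \<open>A \<otimes> \<int>\<close> are the maps on \<open>A(1\<^sub>+)\<close> satisfying the following conditions.
\<close>

definition additive_character :: "'a f1alg \<Rightarrow> 'r ring \<Rightarrow> ('a \<Rightarrow> 'r) \<Rightarrow> bool" where
  "additive_character A R f \<longleftrightarrow>
    f \<in> hom (f1alg_monoid A) R \<and> f (gunit A) = \<one>\<^bsub>R\<^esub> \<and> f (gbase A 1) = \<zero>\<^bsub>R\<^esub> \<and>
    (\<forall>a\<in>gobj A 1. \<forall>b\<in>gobj A 1. \<forall>c\<in>gobj A 1. c \<in> binary_sum A a b \<longrightarrow> f c = f a \<oplus>\<^bsub>R\<^esub> f b)"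

text \<open>The extension of \<open>f\<close> to the monoid ring kills each relation: the basepoint
  by \<open>f (gbase A 1) = \<zero>\<close>, the others by additivity along binary sums. Its kernel
  is an ideal, so it contains \<open>sum_ideal A\<close> and the extension descends to the
  quotient.\<close>

lemma alg_tensor_lift:
  fixes R :: "'r ring" (structure)
  assumes A: "commutative_f1_algebra A" and R: "cring R" and f: "additive_character A R f"
  shows "\<exists>g. g \<in> cring_hom (alg_tensor A) R \<and> (\<forall>a\<in>gobj A 1. g (alg_gen A a) = f a)"
proof -
  let ?M = "monoid_ring (f1alg_monoid A)"
  interpret M: cring ?M
    by (rule cring_monoid_ring[OF comm_monoid_f1alg_monoid[OF A]])
  interpret R: cring R by fact
  have fh: "f \<in> hom (f1alg_monoid A) R"
    using f by (simp add: additive_character_def)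
  then obtain h where h: "h \<in> ring_hom ?M R" and h_of': "\<And>a. a \<in> carrier (f1alg_monoid A) \<Longrightarrow> h (frag_of a) = f a"
    using ring_hom_monoid_ring_lift[OF R fh _ comm_monoid.axioms(1)[OF comm_monoid_f1alg_monoid[OF A]]] f
    by (auto simp: additive_character_def)
  have h_of: "h (frag_of a) = f a" if "a \<in> gobj A 1" for a
    using h_of' that by simp
  interpret h: ring_hom_ring ?M R h
    using h by (intro ring_hom_ringI2 M.ring_axioms R.ring_axioms)
  have sub: "sum_relations A \<subseteq> carrier ?M"
    using sum_relations_subset[OF commutative_f1_algebra_gamma_set[OF A]] by auto
  have "r \<in> a_kernel ?M R h" if r: "r \<in> sum_relations A" for r
  proof -
    have "h r = \<zero>"
    proof (cases "r = frag_of (gbase A 1)")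
      case True
      then show ?thesis
        using f h_of gamma_set.gbase_closed[OF commutative_f1_algebra_gamma_set[OF A]]
        by (simp add: additive_character_def)
    next
      case False
      then obtain x y w where r: "r = frag_of x + frag_of y - frag_of w"
        and mem: "x \<in> gobj A 1" "y \<in> gobj A 1" "w \<in> gobj A 1" "w \<in> binary_sum A x y"
        using r unfolding sum_relations_def by blast
      have keys: "Poly_Mapping.keys (frag_of x + frag_of y) \<subseteq> carrier (f1alg_monoid A)"
        using keys_add[of "frag_of x" "frag_of y"] mem by auto
      have "h r = h (frag_of x + frag_of y) \<ominus> h (frag_of w)"
        unfolding r using mem keys by (intro ring_hom_monoid_ring_diff[OF R.ring_axioms h]) auto
      also have "h (frag_of x + frag_of y) = f x \<oplus> f y"
        using ring_hom_add[OF h, of "frag_of x" "frag_of y"] mem h_of by simp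
      also have "f x \<oplus> f y = f w"
        using f mem by (simp add: additive_character_def)
      also have "f w \<ominus> h (frag_of w) = \<zero>"
        using h_of[OF mem(3)] fh mem(3) by (simp add: hom_def Pi_iff R.r_neg R.minus_eq)
      finally show ?thesis .
    qed
    then show ?thesis
      using subsetD[OF sub r] unfolding a_kernel_def' by blast
  qed
  then have "sum_ideal A \<subseteq> a_kernel ?M R h"
    unfolding sum_ideal_def by (intro M.genideal_minimal h.kernel_is_ideal) blast
  then obtain g where g: "g \<in> ring_hom (alg_tensor A) R" "\<And>c. c \<in> carrier ?M \<Longrightarrow> g (alg_coset A c) = h c"
    using ring_hom_Quot_lift[OF ideal_sum_ideal[OF A] R.ring_axioms h] unfolding alg_tensor_def
    by metis
  \<comment> \<open>Hom-sets consist of extensional maps, so the factorisation is cut down to the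
    carrier.\<close>
  let ?g = "restrict g (carrier (alg_tensor A))"
  interpret T: cring "alg_tensor A" by (rule cring_alg_tensor[OF A])
  have "?g \<in> cring_hom (alg_tensor A) R"
    using g(1) by (auto simp: cring_hom_def ring_hom_def)
  moreover have "?g (alg_gen A a) = f a" if "a \<in> gobj A 1" for a
  proof -
    have "frag_of a \<in> carrier ?M" using that by simp
    then show ?thesis
      using g(2) ring_hom_closed[OF alg_coset_hom[OF A]] h_of[OF that] by simp
  qed
  ultimately show ?thesis by blast
qed

text \<open>Composing \<open>g\<close> with the quotient map yields a ring homomorphism on the
  monoid ring that vanishes on the relations; the clauses are read off from it on
  generators.\<close>

lemma additive_character_alg_gen:
  fixes R :: "'r ring" (structure)
  assumes A: "commutative_f1_algebra A" and R: "cring R" and g: "g \<in> cring_hom (alg_tensor A) R"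
  shows "additive_character A R (\<lambda>a. g (alg_gen A a))"
proof -
  let ?M = "monoid_ring (f1alg_monoid A)"
  interpret A: commutative_f1_algebra A by fact
  interpret M: cring ?M
    by (rule cring_monoid_ring[OF comm_monoid_f1alg_monoid[OF A]])
  interpret R: cring R by fact
  interpret I: ideal "sum_ideal A" ?M by (rule ideal_sum_ideal[OF A])
  let ?G = "g \<circ> alg_coset A"
  have G: "?G \<in> ring_hom ?M R"
    using ring_hom_trans[OF alg_coset_hom[OF A]] g by (auto simp: cring_hom_def)
  have G0: "?G r = \<zero>" if "r \<in> sum_relations A" for r
  proof -
    have "sum_relations A \<subseteq> carrier ?M"
      using sum_relations_subset[OF commutative_f1_algebra_gamma_set[OF A]] by auto
    then have "r \<in> sum_ideal A"
      unfolding sum_ideal_def using M.genideal_self that by blast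
    then have "alg_coset A r = alg_coset A \<zero>\<^bsub>?M\<^esub>"
      using M.a_coset_join2[OF _ I.a_subgroup] I.a_Hcarr[of r] I.zero_closed M.zero_closed by metis
    then show ?thesis
      using ring_hom_zero[OF G M.ring_axioms R.ring_axioms] by simp
  qed
  have closed: "?G (frag_of a) \<in> carrier R" if "a \<in> gobj A 1" for a
    using ring_hom_closed[OF G] that by simp
  have mult: "?G (frag_of (gmul A 1 1 a b)) = ?G (frag_of a) \<otimes> ?G (frag_of b)"
    if "a \<in> gobj A 1" "b \<in> gobj A 1" for a b
    using ring_hom_mult[OF G, of "frag_of a" "frag_of b"] that by simp
  have add: "?G (frag_of c) = ?G (frag_of a) \<oplus> ?G (frag_of b)"
    if mem: "a \<in> gobj A 1" "b \<in> gobj A 1" "c \<in> gobj A 1" "c \<in> binary_sum A a b" for a b c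
  proof -
    let ?r = "frag_of a + frag_of b - frag_of c"
    have r: "?r \<in> sum_relations A"
      by (rule sum_relationsI[OF mem])
    then have rc: "?r \<in> carrier ?M"
      using subsetD[OF sum_relations_subset[OF commutative_f1_algebra_gamma_set[OF A]]] by simp
    \<comment> \<open>The relation plus \<open>frag_of c\<close> is
      \<open>frag_of a + frag_of b\<close>, and the relation itself is killed.\<close>
    have "?G (frag_of a) \<oplus> ?G (frag_of b) = ?G (?r \<oplus>\<^bsub>?M\<^esub> frag_of c)"
      using ring_hom_add[OF G, of "frag_of a" "frag_of b"] mem by simp
    also have "\<dots> = ?G ?r \<oplus> ?G (frag_of c)"
      using ring_hom_add[OF G rc, of "frag_of c"] mem by simp
    also have "\<dots> = ?G (frag_of c)"
      using G0[OF r] closed[OF mem(3)] by simp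
    finally show ?thesis ..
  qed
  have "?G (frag_of (gunit A)) = \<one>"
    using ring_hom_one[OF G] by simp
  moreover have "?G (frag_of (gbase A 1)) = \<zero>"
    by (rule G0) (simp add: sum_relations_def)
  ultimately show ?thesis
    using closed mult add by (auto simp: additive_character_def hom_def)
qed

section \<open>Indicator maps and coordinates\<close>

definition gamma_ind :: "nat \<Rightarrow> nat set \<Rightarrow> nat \<Rightarrow> nat" where
  "gamma_ind n S = (\<lambda>k\<in>{..n}. if k \<in> S then 1 else 0)"

lemma gamma_ind: "0 \<notin> S \<Longrightarrow> gamma_ind n S \<in> gamma_maps n 1"
  by (auto simp: gamma_ind_def gamma_maps_def)

text \<open>The projection in degree \<open>1\<close> is trivial, which is why the coordinate
  formula gives back \<open>f\<close> there.\<close>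

lemma gamma_ind_1: "gamma_ind 1 {1} = (\<lambda>i\<in>{..1}. i)"
  by (rule ext) (auto simp: gamma_ind_def)

text \<open>
  Adding the coordinates \<open>i \<in> S\<close> one at a time: the map \<open>n\<^sub>+ \<rightarrow> 2\<^sub>+\<close> sending \<open>i\<close> to \<open>1\<close> and \<open>S\<close> to
  \<open>2\<close> exhibits the image of \<open>x\<close> for \<open>S \<union> {i}\<close> as a binary sum.
\<close>

lemma additive_gamma_ind:
  fixes R :: "'r ring" (structure)
  assumes "gamma_set X" "abelian_group R"
    and f: "f \<in> gobj X 1 \<rightarrow> carrier R" "f (gbase X 1) = \<zero>"
      "\<And>a b c. \<lbrakk>a \<in> gobj X 1; b \<in> gobj X 1; c \<in> gobj X 1; c \<in> binary_sum X a b\<rbrakk> \<Longrightarrow> f c = f a \<oplus> f b"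
    and S: "finite S" "S \<subseteq> {1..n}" and x: "x \<in> gobj X n"
  shows "f (gmap X n 1 (gamma_ind n S) x) = (\<Oplus>i\<in>S. f (gmap X n 1 (gamma_ind n {i}) x))"
  using S
proof (induction S rule: finite_induct)
  interpret X: gamma_set X by fact
  interpret R: abelian_group R by fact
  {
    case empty
    \<comment> \<open>The indicator of the empty set factors through \<open>0\<^sub>+\<close>, where
      \<open>X\<close> is a point. So it yields the basepoint, matching the empty sum.\<close>
    let ?z = "\<lambda>m. \<lambda>k\<in>{..m::nat}. 0::nat"
    have z: "?z n \<in> gamma_maps n 0" "?z 0 \<in> gamma_maps 0 1"
      by (auto simp: gamma_maps_def)
    have "gamma_ind n {} = compose {..n} (?z 0) (?z n)"
      by (rule ext) (auto simp: gamma_ind_def compose_def)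
    then have "gmap X n 1 (gamma_ind n {}) x = gmap X 0 1 (?z 0) (gmap X n 0 (?z n) x)"
      using X.gmap_comp[OF z x] by simp
    also have "gmap X n 0 (?z n) x = gbase X 0"
      using X.gmap_closed[OF z(1) x] X.gobj_0 by simp
    also have "gmap X 0 1 (?z 0) (gbase X 0) = gbase X 1"
      by (rule X.gmap_base[OF z(2)])
    finally show ?case by (simp add: f(2))
  next
    case (insert i S)
    define q where "q = (\<lambda>k\<in>{..n}. if k = i then 1 else if k \<in> S then 2 else 0::nat)"
    have S0: "0 \<notin> S" "0 \<noteq> i" "0 \<notin> insert i S"
      using insert.prems by auto
    have q: "q \<in> gamma_maps n 2"
      using S0 by (auto simp: q_def gamma_maps_def)
    have "compose {..n} gamma_p1 q = gamma_ind n {i}"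
      by (rule ext) (auto simp: gamma_ind_def gamma_p1_def q_def compose_def)
    moreover have "compose {..n} gamma_p2 q = gamma_ind n S"
      using insert.hyps by (intro ext) (auto simp: gamma_ind_def gamma_p2_def q_def compose_def)
    moreover have "compose {..n} gamma_s q = gamma_ind n (insert i S)"
      by (rule ext) (auto simp: gamma_ind_def gamma_s_def q_def compose_def)
    ultimately have "gmap X n 1 (gamma_ind n (insert i S)) x \<in>
        binary_sum X (gmap X n 1 (gamma_ind n {i}) x) (gmap X n 1 (gamma_ind n S) x)"
      using X.gmap_comp[OF q gamma_p1 x] X.gmap_comp[OF q gamma_p2 x] X.gmap_comp[OF q gamma_s x]
      by (intro binary_sumI[OF X.gmap_closed[OF q x]]) simp_all
    then have "f (gmap X n 1 (gamma_ind n (insert i S)) x) =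
        f (gmap X n 1 (gamma_ind n {i}) x) \<oplus> f (gmap X n 1 (gamma_ind n S) x)"
      using S0 by (intro f(3) X.gmap_closed[OF gamma_ind x]) auto
    moreover have "f (gmap X n 1 (gamma_ind n {k}) x) \<in> carrier R" if "k \<in> insert i S" for k
      using X.gmap_closed[OF gamma_ind x, of "{k}"] that f(1) S0 by (metis Pi_iff singletonD)
    ultimately show ?case
      using insert by (simp add: R.finsum_insert Pi_iff)
  }
qed

text \<open>The fibre over \<open>1\<close> is the single index \<open>i\<close>, so the sum
  defining \<open>gmap\<close> collapses to one entry.\<close>

lemma EM_gmap_gamma_ind:
  fixes R :: "'r ring" (structure)
  assumes "cring R" "r \<in> {1..n} \<rightarrow>\<^sub>E carrier R" "i \<in> {1..n}"
  shows "gmap (EM R) n 1 (gamma_ind n {i}) r 1 = r i"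
proof -
  interpret cring R by fact
  have "{k \<in> {1..n}. gamma_ind n {i} k = 1} = {i}"
    using assms(3) by (auto simp: gamma_ind_def split: if_splits)
  then show ?thesis
    using assms by (subst EM_gmap_apply) (auto simp: PiE_iff)
qed

text \<open>Naturality at the projection \<open>gamma_ind n {i}\<close>. A morphism into
  \<open>EM R\<close> is therefore determined by its degree \<open>1\<close> component.\<close>

lemma gset_hom_EM_component:
  assumes "cring R" "\<phi> \<in> gset_hom X (EM R)" "x \<in> gobj X n" "i \<in> {1..n}"
  shows "\<phi> n x i = \<phi> 1 (gmap X n 1 (gamma_ind n {i}) x) 1"
proof -
  have "\<phi> n x \<in> {1..n} \<rightarrow>\<^sub>E carrier R"
    using gset_hom_closed[OF assms(2,3)] by (simp only: EM_simps)
  moreover have "\<phi> 1 (gmap X n 1 (gamma_ind n {i}) x) = gmap (EM R) n 1 (gamma_ind n {i}) (\<phi> n x)"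
    using assms(4) by (intro gset_hom_natural[OF assms(2) gamma_ind assms(3)]) auto
  ultimately show ?thesis
    using EM_gmap_gamma_ind[OF assms(1) _ assms(4)] by simp
qed

text \<open>A witness is a pair of elements of \<open>R\<close>; \<open>gamma_p1\<close> and
  \<open>gamma_p2\<close> read off its entries and \<open>gamma_s\<close> adds them.\<close>

lemma EM_binary_sum:
  fixes R :: "'r ring" (structure)
  assumes "cring R" "w \<in> binary_sum (EM R) u v"
  shows "w 1 = u 1 \<oplus> v 1"
proof -
  interpret cring R by fact
  obtain z where z: "z \<in> gobj (EM R) 2" "gmap (EM R) 2 1 gamma_p1 z = u"
    "gmap (EM R) 2 1 gamma_p2 z = v" "gmap (EM R) 2 1 gamma_s z = w"
    using assms(2) unfolding binary_sum_def by blast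
  have zc: "z 1 \<in> carrier R" "z 2 \<in> carrier R"
    using z(1) by (auto simp: PiE_iff)
  have "{i \<in> {1..2}. gamma_p1 i = 1} = {1}" "{i \<in> {1..2}. gamma_p2 i = 1} = {2}"
    "{i \<in> {1..2}. gamma_s i = 1} = {1, 2}"
    by (auto simp: gamma_p1_def gamma_p2_def gamma_s_def split: if_splits)
  then have "u 1 = z 1" "v 1 = z 2" "w 1 = z 1 \<oplus> z 2"
    unfolding z(2-4)[symmetric] using zc by (simp_all add: EM_gmap_apply del: EM_simps(3))
  then show ?thesis by simp
qed

text \<open>Evaluation at the index \<open>1\<close> identifies degree \<open>1\<close> of
  \<open>EM R\<close> with \<open>R\<close>. Additivity comes from preservation of binary sums,
  which in \<open>EM R\<close> are ordinary sums.\<close>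

lemma additive_character_f1alg_hom:
  fixes R :: "'r ring" (structure)
  assumes A: "commutative_f1_algebra A" and R: "cring R" and \<phi>: "\<phi> \<in> f1alg_hom A (EM R)"
  shows "additive_character A R (\<lambda>a. \<phi> 1 a 1)"
proof -
  note \<phi>g = f1alg_hom_gset_hom[OF \<phi>]
  have closed: "\<phi> 1 a 1 \<in> carrier R" if "a \<in> gobj A 1" for a
    using gset_hom_closed[OF \<phi>g that] by (auto simp: PiE_iff)
  have "\<phi> (1 * 1) (gmul A 1 1 a b) = gmul (EM R) 1 1 (\<phi> 1 a) (\<phi> 1 b)"
    if "a \<in> gobj A 1" "b \<in> gobj A 1" for a b
    using \<phi> that unfolding f1alg_hom_def by blast
  then have "\<phi> 1 (gmul A 1 1 a b) 1 = \<phi> 1 a 1 \<otimes> \<phi> 1 b 1"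
    if "a \<in> gobj A 1" "b \<in> gobj A 1" for a b
    using that by (simp add: smash_fst_def smash_snd_def)
  moreover have "\<phi> 1 (gunit A) 1 = \<one>" "\<phi> 1 (gbase A 1) 1 = \<zero>"
    using \<phi> gset_hom_base[OF \<phi>g, of 1] by (auto simp: f1alg_hom_def)
  ultimately show ?thesis
    using closed EM_binary_sum[OF R gset_hom_binary_sum[OF \<phi>g]]
    by (auto simp: additive_character_def hom_def)
qed

text \<open>An index is determined by its two smash coordinates, so equality with \<open>k\<close>
  may be tested on each of them. This turns a coordinate of a product into a product of
  coordinates.\<close>

lemma gamma_ind_smash:
  assumes "k \<in> {1..m * n}"
  shows "gamma_ind (m * n) {k} =
    smash_map m n 1 (gamma_ind m {smash_fst n k}) (gamma_ind n {smash_snd n k})"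
proof (rule ext)
  fix l
  show "gamma_ind (m * n) {k} l =
    smash_map m n 1 (gamma_ind m {smash_fst n k}) (gamma_ind n {smash_snd n k}) l"
  proof (cases "l \<in> {1..m * n}")
    case True
    have "l = k \<longleftrightarrow> smash_fst n l = smash_fst n k \<and> smash_snd n l = smash_snd n k"
      using smash_pair_fst_snd[of l n] smash_pair_fst_snd[of k n] assms True by (metis atLeastAtMost_iff)
    then show ?thesis
      using True smash_fst_mem[OF True] smash_snd_mem[OF True]
      by (auto simp: gamma_ind_def smash_map_def smash_pair_def)
  next
    case False
    then have "l = 0 \<or> l > m * n" by auto
    then show ?thesis
      using assms by (auto simp: gamma_ind_def smash_map_def)
  qed
qed

text \<open>The construction inverse to restriction to degree \<open>1\<close>; the formula is
  forced by \<open>gset_hom_EM_component\<close>.\<close>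

definition coordinate_map :: "'a f1alg \<Rightarrow> ('a \<Rightarrow> 'r) \<Rightarrow> nat \<Rightarrow> 'a \<Rightarrow> nat \<Rightarrow> 'r" where
  "coordinate_map A f = (\<lambda>n. \<lambda>x\<in>gobj A n. \<lambda>i\<in>{1..n}. f (gmap A n 1 (gamma_ind n {i}) x))"

lemma coordinate_map_1:
  assumes "commutative_f1_algebra A" "a \<in> gobj A 1"
  shows "coordinate_map A f 1 a 1 = f a"
proof -
  interpret commutative_f1_algebra A by fact
  show ?thesis
    using assms(2) by (simp add: coordinate_map_def gamma_ind_1 gmap_id)
qed

lemma coordinate_map_hom:
  fixes R :: "'r ring" (structure)
  assumes A: "commutative_f1_algebra A" and R: "cring R" and f: "additive_character A R f"
  shows "coordinate_map A f \<in> f1alg_hom A (EM R)"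
proof -
  interpret A: commutative_f1_algebra A by fact
  interpret R: cring R by fact
  have fh: "f \<in> gobj A 1 \<rightarrow> carrier R"
    and f_mult: "\<And>a b. \<lbrakk>a \<in> gobj A 1; b \<in> gobj A 1\<rbrakk> \<Longrightarrow> f (gmul A 1 1 a b) = f a \<otimes> f b"
    and f_one: "f (gunit A) = \<one>" and f_base: "f (gbase A 1) = \<zero>"
    and f_sum: "\<And>a b c. \<lbrakk>a \<in> gobj A 1; b \<in> gobj A 1; c \<in> gobj A 1; c \<in> binary_sum A a b\<rbrakk> \<Longrightarrow>
      f c = f a \<oplus> f b"
    using f by (auto simp: additive_character_def hom_def)
  have ind: "gamma_ind n {i} \<in> gamma_maps n 1" if "i \<in> {1..m}" for n m i
    using that by (intro gamma_ind) auto
  have mem: "coordinate_map A f n \<in> gobj A n \<rightarrow>\<^sub>E gobj (EM R) n" for n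
    using A.gmap_closed[OF ind] fh by (auto simp: coordinate_map_def Pi_iff)
  have base: "coordinate_map A f n (gbase A n) = gbase (EM R) n" for n
    using A.gmap_base[OF ind] f_base A.gbase_closed
    by (auto simp: coordinate_map_def intro!: restrict_ext)
  have natural: "coordinate_map A f n (gmap A m n g x) = gmap (EM R) m n g (coordinate_map A f m x)"
    if g: "g \<in> gamma_maps m n" and x: "x \<in> gobj A m" for m n g x
  proof (rule extensionalityI)
    fix j assume j: "j \<in> {1..n}"
    let ?S = "{i \<in> {1..m}. g i = j}"
    \<comment> \<open>As \<open>j\<close> is nonzero and \<open>g\<close> is pointed, the fibre over
      \<open>j\<close> misses \<open>0\<close>; so \<open>g\<close> followed by the projection to
      \<open>j\<close> is the indicator of that fibre.\<close>
    have "g 0 = 0" "\<And>k. k \<le> m \<Longrightarrow> g k \<le> n"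
      using g by (auto simp: gamma_maps_def PiE_iff)
    then have "k \<in> ?S \<longleftrightarrow> g k = j" if "k \<le> m" for k
      using that j by (cases "k = 0") auto
    then have comp: "compose {..m} (gamma_ind n {j}) g = gamma_ind m ?S"
      using \<open>\<And>k. k \<le> m \<Longrightarrow> g k \<le> n\<close> by (intro ext) (auto simp: compose_def gamma_ind_def)
    have "coordinate_map A f n (gmap A m n g x) j = f (gmap A n 1 (gamma_ind n {j}) (gmap A m n g x))"
      using j A.gmap_closed[OF g x] by (simp add: coordinate_map_def)
    also have "\<dots> = f (gmap A m 1 (gamma_ind m ?S) x)"
      using A.gmap_comp[OF g ind[OF j] x] comp by simp
    \<comment> \<open>Iterated binary sums produce exactly the fibre sum by which
      \<open>gmap (EM R)\<close> is defined.\<close>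
    also have "\<dots> = (\<Oplus>i\<in>?S. f (gmap A m 1 (gamma_ind m {i}) x))"
      by (rule additive_gamma_ind[OF A.gamma_set_axioms R.abelian_group_axioms fh f_base f_sum _ _ x])
        auto
    also have "\<dots> = (\<Oplus>i\<in>?S. coordinate_map A f m x i)"
    proof (rule R.finsum_cong')
      show "(\<lambda>i. coordinate_map A f m x i) \<in> ?S \<rightarrow> carrier R"
        using mem[of m] x by (auto simp: PiE_iff)
    qed (use x in \<open>auto simp: coordinate_map_def\<close>)
    finally show "coordinate_map A f n (gmap A m n g x) j = gmap (EM R) m n g (coordinate_map A f m x) j"
      unfolding EM_gmap_apply[OF j] .
  qed (use A.gmap_closed[OF g x] in \<open>auto simp: coordinate_map_def\<close>)
  have mult: "coordinate_map A f (m * n) (gmul A m n x y) =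
      gmul (EM R) m n (coordinate_map A f m x) (coordinate_map A f n y)"
    if x: "x \<in> gobj A m" and y: "y \<in> gobj A n" for m n x y
  proof (rule extensionalityI)
    fix k assume k: "k \<in> {1..m * n}"
    note fk = smash_fst_mem[OF k] and sk = smash_snd_mem[OF k]
    \<comment> \<open>The target degree is written \<open>1 * 1\<close>, the form in which
      \<open>gmul_natural\<close> produces it.\<close>
    have "coordinate_map A f (m * n) (gmul A m n x y) k =
        f (gmap A (m * n) (1 * 1) (smash_map m n 1 (gamma_ind m {smash_fst n k}) (gamma_ind n {smash_snd n k}))
          (gmul A m n x y))"
      using k A.gmul_closed[OF x y] by (simp add: coordinate_map_def gamma_ind_smash[OF k])
    also have "\<dots> = f (gmul A 1 1 (gmap A m 1 (gamma_ind m {smash_fst n k}) x)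
        (gmap A n 1 (gamma_ind n {smash_snd n k}) y))"
      using A.gmul_natural[OF ind[OF fk] ind[OF sk] x y] by simp
    also have "\<dots> = coordinate_map A f m x (smash_fst n k) \<otimes> coordinate_map A f n y (smash_snd n k)"
      using x y fk sk
      by (simp add: f_mult A.gmap_closed[OF ind[OF fk]] A.gmap_closed[OF ind[OF sk]] coordinate_map_def)
    finally show "coordinate_map A f (m * n) (gmul A m n x y) k =
        gmul (EM R) m n (coordinate_map A f m x) (coordinate_map A f n y) k"
      using k by simp
  qed (use A.gmul_closed[OF x y] in \<open>auto simp: coordinate_map_def\<close>)
  have "coordinate_map A f 1 (gunit A) = gunit (EM R)"
  proof (rule extensionalityI)
    fix i :: nat assume "i \<in> {1..1}"
    then have "i = 1" by simp
    then show "coordinate_map A f 1 (gunit A) i = gunit (EM R) i"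
      using coordinate_map_1[OF A A.gunit_closed, of f] f_one by simp
  qed (use A.gunit_closed in \<open>auto simp: coordinate_map_def\<close>)
  then show ?thesis
    using mem base natural mult unfolding f1alg_hom_def gset_hom_def by blast
qed

section \<open>The bijection of hom-sets and its naturality\<close>

definition adjunct :: "'a f1alg \<Rightarrow> 'r ring \<Rightarrow> (nat \<Rightarrow> 'a \<Rightarrow> nat \<Rightarrow> 'r) \<Rightarrow> ('a \<Rightarrow>\<^sub>0 int) set \<Rightarrow> 'r" where
  "adjunct A R \<phi> =
    (THE g. g \<in> cring_hom (alg_tensor A) R \<and> (\<forall>a\<in>gobj A 1. g (alg_gen A a) = \<phi> 1 a 1))"

text \<open>Values on generators fix a ring homomorphism out of \<open>alg_tensor A\<close>, so any
  candidate with the right values is the one described. Surjectivity and naturality both go through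
  this.\<close>

lemma adjunct_equality:
  assumes "commutative_f1_algebra A" "cring R" "g \<in> cring_hom (alg_tensor A) R"
    "\<And>a. a \<in> gobj A 1 \<Longrightarrow> g (alg_gen A a) = \<phi> 1 a 1"
  shows "adjunct A R \<phi> = g"
  unfolding adjunct_def
proof (rule the_equality)
  fix h assume "h \<in> cring_hom (alg_tensor A) R \<and> (\<forall>a\<in>gobj A 1. h (alg_gen A a) = \<phi> 1 a 1)"
  then show "h = g"
    using assms(4) by (intro alg_tensor_hom_eqI[OF assms(1,2) _ assms(3)]) auto
qed (use assms in auto)

text \<open>The candidate comes from \<open>alg_tensor_lift\<close>, applied to the character read
  off from \<open>\<phi>\<close> in degree \<open>1\<close>.\<close>

lemma
  assumes "commutative_f1_algebra A" "cring R" "\<phi> \<in> f1alg_hom A (EM R)"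
  shows adjunct_hom: "adjunct A R \<phi> \<in> cring_hom (alg_tensor A) R"
    and adjunct_alg_gen: "a \<in> gobj A 1 \<Longrightarrow> adjunct A R \<phi> (alg_gen A a) = \<phi> 1 a 1"
proof -
  obtain g where g: "g \<in> cring_hom (alg_tensor A) R" "\<And>a. a \<in> gobj A 1 \<Longrightarrow> g (alg_gen A a) = \<phi> 1 a 1"
    using alg_tensor_lift[OF assms(1,2) additive_character_f1alg_hom[OF assms]] by blast
  have eq: "adjunct A R \<phi> = g"
    using assms(1,2) g by (rule adjunct_equality)
  show "adjunct A R \<phi> \<in> cring_hom (alg_tensor A) R"
    and "a \<in> gobj A 1 \<Longrightarrow> adjunct A R \<phi> (alg_gen A a) = \<phi> 1 a 1"
    using g by (simp_all add: eq)
qed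

text \<open>Equal adjuncts agree on generators, so the morphisms agree in degree \<open>1\<close>
  and then, coordinate by coordinate, in every degree. A preimage of \<open>g\<close> is the
  \<open>coordinate_map\<close> of its restriction to generators.\<close>

lemma adjunct_bij:
  assumes A: "commutative_f1_algebra A" and R: "cring R"
  shows "bij_betw (adjunct A R) (f1alg_hom A (EM R)) (cring_hom (alg_tensor A) R)"
proof (rule bij_betw_imageI)
  interpret A: commutative_f1_algebra A by fact
  show "inj_on (adjunct A R) (f1alg_hom A (EM R))"
  proof (rule inj_onI)
    fix \<phi> \<psi> assume \<phi>: "\<phi> \<in> f1alg_hom A (EM R)" and \<psi>: "\<psi> \<in> f1alg_hom A (EM R)"
      and eq: "adjunct A R \<phi> = adjunct A R \<psi>"
    note \<phi>g = f1alg_hom_gset_hom[OF \<phi>] and \<psi>g = f1alg_hom_gset_hom[OF \<psi>]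
    have eq1: "\<phi> 1 a 1 = \<psi> 1 a 1" if "a \<in> gobj A 1" for a
      using adjunct_alg_gen[OF A R \<phi> that] adjunct_alg_gen[OF A R \<psi> that] eq by simp
    have eqn: "\<phi> n x = \<psi> n x" if x: "x \<in> gobj A n" for n x
    proof (rule extensionalityI)
      fix i assume i: "i \<in> {1..n}"
      then have "gmap A n 1 (gamma_ind n {i}) x \<in> gobj A 1"
        by (intro A.gmap_closed[OF gamma_ind x]) auto
      then show "\<phi> n x i = \<psi> n x i"
        using gset_hom_EM_component[OF R \<phi>g x i] gset_hom_EM_component[OF R \<psi>g x i] eq1 by simp
    qed (use gset_hom_closed[OF \<phi>g x] gset_hom_closed[OF \<psi>g x] in \<open>simp_all add: PiE_iff\<close>)
    show "\<phi> = \<psi>"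
    proof (rule ext)
      show "\<phi> n = \<psi> n" for n
        using gset_hom_ext[OF \<phi>g] gset_hom_ext[OF \<psi>g] eqn by (rule extensionalityI)
    qed
  qed
  show "adjunct A R ` f1alg_hom A (EM R) = cring_hom (alg_tensor A) R"
  proof
    show "adjunct A R ` f1alg_hom A (EM R) \<subseteq> cring_hom (alg_tensor A) R"
      using adjunct_hom[OF A R] by blast
    show "cring_hom (alg_tensor A) R \<subseteq> adjunct A R ` f1alg_hom A (EM R)"
    proof
      fix g assume g: "g \<in> cring_hom (alg_tensor A) R"
      let ?\<phi> = "coordinate_map A (\<lambda>a. g (alg_gen A a))"
      have "?\<phi> \<in> f1alg_hom A (EM R)"
        by (rule coordinate_map_hom[OF A R additive_character_alg_gen[OF A R g]])
      moreover have "adjunct A R ?\<phi> = g"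
        using A R g by (rule adjunct_equality) (simp add: coordinate_map_1[OF A])
      ultimately show "g \<in> adjunct A R ` f1alg_hom A (EM R)"
        by (intro image_eqI[where x = ?\<phi>]) simp_all
    qed
  qed
qed

text \<open>By \<open>adjunct_equality\<close> it is enough to evaluate at a generator
  \<open>a\<close>, where both sides give
  \<open>\<beta> (\<phi> 1 (\<alpha> 1 a) 1)\<close>.\<close>

lemma adjunct_natural:
  assumes A: "commutative_f1_algebra A" and A': "commutative_f1_algebra A'"
    and R: "cring R" and R': "cring R'"
    and \<alpha>: "\<alpha> \<in> f1alg_hom A' A" and \<beta>: "\<beta> \<in> cring_hom R R'" and \<phi>: "\<phi> \<in> f1alg_hom A (EM R)"
  shows "adjunct A' R' (gset_comp A' (EM_map R R' \<beta>) (gset_comp A' \<phi> \<alpha>)) =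
    compose (carrier (alg_tensor A')) \<beta>
      (compose (carrier (alg_tensor A')) (adjunct A R \<phi>) (alg_tensor_map A' A \<alpha>))"
proof (rule adjunct_equality[OF A' R'])
  let ?g = "compose (carrier (alg_tensor A')) \<beta>
      (compose (carrier (alg_tensor A')) (adjunct A R \<phi>) (alg_tensor_map A' A \<alpha>))"
  show "?g \<in> cring_hom (alg_tensor A') R'"
    by (rule cring_hom_compose[OF cring_hom_compose[OF alg_tensor_map_hom[OF A' A \<alpha>] adjunct_hom[OF A R \<phi>]] \<beta>])
      (rule cring_alg_tensor[OF A'])+
  fix a assume a: "a \<in> gobj A' 1"
  have fa: "frag_of a \<in> carrier (monoid_ring (f1alg_monoid A'))"
    using a by simp
  have \<alpha>a: "\<alpha> 1 a \<in> gobj A 1"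
    using gset_hom_closed[OF f1alg_hom_gset_hom[OF \<alpha>] a] .
  have "?g (alg_gen A' a) = \<beta> (adjunct A R \<phi> (alg_tensor_map A' A \<alpha> (alg_gen A' a)))"
    using ring_hom_closed[OF alg_coset_hom[OF A'] fa] by (simp add: compose_def)
  also have "\<dots> = \<beta> (\<phi> 1 (\<alpha> 1 a) 1)"
    using alg_tensor_map_coset[OF A' A \<alpha> fa] adjunct_alg_gen[OF A R \<phi> \<alpha>a] by simp
  also have "\<dots> = EM_map R R' \<beta> 1 (\<phi> 1 (\<alpha> 1 a)) 1"
    using gset_hom_closed[OF f1alg_hom_gset_hom[OF \<phi>] \<alpha>a] by (subst EM_map_apply) simp_all
  also have "\<dots> = gset_comp A' (EM_map R R' \<beta>) (gset_comp A' \<phi> \<alpha>) 1 a 1"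
    using a by (simp add: gset_comp_def compose_def)
  finally show "?g (alg_gen A' a) = gset_comp A' (EM_map R R' \<beta>) (gset_comp A' \<phi> \<alpha>) 1 a 1" .
qed

text \<open>The clauses on \<open>gset.truncate\<close> express that the algebra functor extends the
  module functor. As \<open>A\<close> and \<open>EM R\<close> have different element types, the
  hom-sets of the adjunction are \<open>f1alg_hom\<close> and \<open>cring_hom\<close> themselves,
  not those of a single \<open>cat\<close>. The witness for \<open>\<Phi>\<close> is
  \<open>adjunct\<close>.\<close>

theorem theorem3:
  shows
    "cat_functor (F1Mod :: ('a gset, _) cat) Ab mod_tensor mod_tensor_map \<and>
     cat_functor (F1Alg :: ('a f1alg, _) cat) CRing alg_tensor alg_tensor_map \<and>
     (\<forall>A \<in> cat_obj (F1Alg :: ('a f1alg, _) cat).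
        add_monoid (alg_tensor A) = mod_tensor (gset.truncate A)) \<and>
     (\<forall>A \<in> cat_obj (F1Alg :: ('a f1alg, _) cat). \<forall>B \<in> cat_obj F1Alg. \<forall>\<phi> \<in> cat_hom F1Alg A B.
        alg_tensor_map A B \<phi> = mod_tensor_map (gset.truncate A) (gset.truncate B) \<phi>) \<and>
     cat_functor (CRing :: ('r ring, _) cat) F1Alg EM EM_map \<and>
     (\<exists>\<Phi> :: 'a f1alg \<Rightarrow> 'r ring \<Rightarrow> (nat \<Rightarrow> 'a \<Rightarrow> nat \<Rightarrow> 'r) \<Rightarrow> ('a \<Rightarrow>\<^sub>0 int) set \<Rightarrow> 'r.
        (\<forall>A \<in> cat_obj F1Alg. \<forall>R \<in> cat_obj CRing.
           bij_betw (\<Phi> A R) (f1alg_hom A (EM R)) (cring_hom (alg_tensor A) R)) \<and>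
        (\<forall>A \<in> cat_obj F1Alg. \<forall>A' \<in> cat_obj F1Alg. \<forall>R \<in> cat_obj CRing. \<forall>R' \<in> cat_obj CRing.
         \<forall>\<alpha> \<in> cat_hom F1Alg A' A. \<forall>\<beta> \<in> cat_hom CRing R R'. \<forall>\<phi> \<in> f1alg_hom A (EM R).
           \<Phi> A' R' (gset_comp A' (EM_map R R' \<beta>) (gset_comp A' \<phi> \<alpha>)) =
           compose (carrier (alg_tensor A')) \<beta>
             (compose (carrier (alg_tensor A')) (\<Phi> A R \<phi>) (alg_tensor_map A' A \<alpha>))))"
  by (intro conjI exI[of _ adjunct] ballI functor_mod_tensor functor_alg_tensor functor_EM
      add_monoid_alg_tensor alg_tensor_map_eq adjunct_bij adjunct_natural)
    (simp_all add: F1Alg_def CRing_def)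

end
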